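(* Let $1/2<s<1$ and let $\Theta=(\theta_{jk})$ be a real symmetric positive definite $n\times n$ matrix. If $f\in\dot H_s(I)$ solves the system $$\frac1\pi\sum_{k=1}^n\theta_{jk}\int_{I_k}\frac{f_k(x)}{x-y}\,dx=c_j,\qquad y\in I_j,\ 1\le j\le n,$$ for some constants $c_1,\dots,c_n$, then all $c_j=0$ and $f\equiv0$.
   Context: Let $n\in\mathbb N$, $I_j=[\alpha_j,\beta_j]$ with $-\infty<\alpha_1<\beta_1<\alpha_2<\dots<\alpha_n<\beta_n<\infty$, $I=\bigcup_{j=1}^n I_j$. Integrals with $y$ in the interval of integration are Cauchy principal values. For a function $f$ on $I$, $f_j$ denotes the restriction of $f$ to $I_j$ extended by zero outside $I_j$. With the Fourier transform $\tilde f(\xi)=\int_{\mathbb R}f(x)e^{ix\xi}dx$, put $\|f\|_s^2=\int_{\mathbb R}|\tilde f(\xi)|^2(1+|\xi|^2)^s\,d\xi$. Let $C_0^\infty(I)$ be the space of smooth functions on $I$ which vanish at the endpoints of each $I_j$. The Hilbert space $\dot H_s(I)$ is the closure of $C_0^\infty(I)$ in the norm $\big(\sum_{j}\|f_j\|_s^2\big)^{1/2}$. Elements of $\dot H_s(I)$ are continuous, and for $f\in\dot H_s(I)$ the left-hand side of the system is a continuous function of $y$, so the system makes sense pointwise. *)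

theory Defs
  imports "HOL-Analysis.Analysis"
begin

text \<open>
  The intervals are indexed by a finite linearly ordered type; its order encodes their
  left-to-right order on the line. A function on \<open>I\<close> is represented by a function on
  the real line that vanishes outside \<open>I\<close>.
\<close>

definition ordered_intervals :: "('n::{finite,linorder} \<Rightarrow> real) \<Rightarrow> ('n \<Rightarrow> real) \<Rightarrow> bool" where
  "ordered_intervals \<alpha> \<beta> \<longleftrightarrow> (\<forall>j. \<alpha> j < \<beta> j) \<and> (\<forall>j k. j < k \<longrightarrow> \<beta> j < \<alpha> k)"

definition interval_union :: "('n::finite \<Rightarrow> real) \<Rightarrow> ('n \<Rightarrow> real) \<Rightarrow> real set" where
  "interval_union \<alpha> \<beta> = (\<Union>j. {\<alpha> j..\<beta> j})"

definition positive_definite :: "real ^ 'n ^ 'n \<Rightarrow> bool" where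
  "positive_definite A \<longleftrightarrow> (\<forall>x. x \<noteq> 0 \<longrightarrow> x \<bullet> (A *v x) > 0)"

definition zero_ext :: "real set \<Rightarrow> (real \<Rightarrow> complex) \<Rightarrow> real \<Rightarrow> complex" where
  "zero_ext A f x = (if x \<in> A then f x else 0)"

definition fourier :: "(real \<Rightarrow> complex) \<Rightarrow> real \<Rightarrow> complex" where
  "fourier f \<xi> = (LINT x|lborel. f x * exp (\<i> * complex_of_real (x * \<xi>)))"

definition sobolev_sqnorm :: "real \<Rightarrow> (real \<Rightarrow> complex) \<Rightarrow> ennreal" where
  "sobolev_sqnorm s f =
     (\<integral>\<^sup>+ \<xi>. ennreal ((cmod (fourier f \<xi>))\<^sup>2 * (1 + \<bar>\<xi>\<bar>\<^sup>2) powr s) \<partial>lborel)"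

text \<open>Derivatives of all orders exist on \<open>S\<close>, one-sided at boundary points of \<open>S\<close>.\<close>

definition smooth_within :: "(real \<Rightarrow> complex) \<Rightarrow> real set \<Rightarrow> bool" where
  "smooth_within \<phi> S \<longleftrightarrow>
     (\<exists>D :: nat \<Rightarrow> real \<Rightarrow> complex. D 0 = \<phi> \<and>
        (\<forall>m. \<forall>x\<in>S. (D m has_vector_derivative D (Suc m) x) (at x within S)))"

definition C0_inf :: "('n::finite \<Rightarrow> real) \<Rightarrow> ('n \<Rightarrow> real) \<Rightarrow> (real \<Rightarrow> complex) set" where
  "C0_inf \<alpha> \<beta> = {\<phi>. smooth_within \<phi> (interval_union \<alpha> \<beta>)
      \<and> (\<forall>j. \<phi> (\<alpha> j) = 0 \<and> \<phi> (\<beta> j) = 0)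
      \<and> (\<forall>x. x \<notin> interval_union \<alpha> \<beta> \<longrightarrow> \<phi> x = 0)}"

definition Hdot_sqnorm ::
  "real \<Rightarrow> ('n::finite \<Rightarrow> real) \<Rightarrow> ('n \<Rightarrow> real) \<Rightarrow> (real \<Rightarrow> complex) \<Rightarrow> ennreal" where
  "Hdot_sqnorm s \<alpha> \<beta> f = (\<Sum>j\<in>UNIV. sobolev_sqnorm s (zero_ext {\<alpha> j..\<beta> j} f))"

text \<open>
  The closure of \<open>C0_inf\<close> for the norm above, for \<open>s > 1/2\<close>. Its elements are then
  continuous on \<open>I\<close>; requiring continuity picks the continuous representative of each
  almost-everywhere class.
\<close>

definition Hdot :: "real \<Rightarrow> ('n::finite \<Rightarrow> real) \<Rightarrow> ('n \<Rightarrow> real) \<Rightarrow> (real \<Rightarrow> complex) set" where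
  "Hdot s \<alpha> \<beta> = {f. continuous_on (interval_union \<alpha> \<beta>) f
      \<and> (\<forall>x. x \<notin> interval_union \<alpha> \<beta> \<longrightarrow> f x = 0)
      \<and> (\<exists>\<phi> :: nat \<Rightarrow> real \<Rightarrow> complex. (\<forall>m. \<phi> m \<in> C0_inf \<alpha> \<beta>)
            \<and> (\<lambda>m. Hdot_sqnorm s \<alpha> \<beta> (\<lambda>x. f x - \<phi> m x)) \<longlonglongrightarrow> 0)}"

text \<open>The principal value at \<open>y\<close> of the integral of \<open>f x / (x - y)\<close> over \<open>A\<close>.\<close>

definition pv_cauchy :: "real set \<Rightarrow> (real \<Rightarrow> complex) \<Rightarrow> real \<Rightarrow> complex" where
  "pv_cauchy A f y =
     Lim (at_right 0) (\<lambda>\<epsilon>. LINT x:{x \<in> A. \<epsilon> < \<bar>x - y\<bar>}|lborel. f x / complex_of_real (x - y))"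

end

theory Submission
  imports Defs "HOL-Probability.Sinc_Integral" "HOL-Probability.Characteristic_Functions"
begin

text \<open>
  Write \<open>F\<^sub>k\<close> for the Fourier transform of \<open>f\<^sub>k\<close>. On the Fourier side the finite Hilbert
  transform is multiplication by a multiple of the sign of \<open>\<xi>\<close>; composed with differentiation it
  becomes multiplication by \<open>\<bar>\<xi>\<bar>\<close>. Pairing the \<open>j\<close>-th equation with \<open>\<phi>\<^sub>j'\<close>, where \<open>\<phi>\<close> is a test
  function, kills the constant \<open>c\<^sub>j\<close> and shows that \<open>f\<close> is orthogonal to \<open>\<phi>\<close> for the form
  \<open>B(u, v) = \<Sum>\<^sub>j\<^sub>k \<theta>\<^sub>j\<^sub>k \<integral> \<bar>\<xi>\<bar> U\<^sub>k cnj V\<^sub>j\<close>. As \<open>\<Theta>\<close> is positive definite,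
  \<open>B(f, f) \<le> B(f, f) + B(\<phi>, \<phi>) = B(f - \<phi>, f - \<phi>)\<close>, and the right-hand side is at most a constant times
  the squared norm of \<open>f - \<phi>\<close> because \<open>s \<ge> 1/2\<close>. Letting \<open>\<phi>\<close> tend to \<open>f\<close> gives \<open>B(f, f) = 0\<close>, so \<open>f = 0\<close>
  by Fourier inversion.
\<close>

section \<open>Fourier inversion\<close>

text \<open>The bound \<open>B * cmod (a x * b y)\<close> is integrable on the product, so the two
  integrals may be exchanged. The kernels it serves are exponentials and sines, all bounded by
  1.\<close>

lemma Fubini_bounded_kernel:
  fixes a b :: "real \<Rightarrow> complex" and k :: "real \<Rightarrow> real \<Rightarrow> complex"
  assumes a: "integrable lborel a" and b: "integrable lborel b"
    and k[measurable]: "case_prod k \<in> borel_measurable (lborel \<Otimes>\<^sub>M lborel)"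
    and bound: "\<And>x y. cmod (k x y) \<le> B"
  shows "(LINT x|lborel. a x * (LINT y|lborel. b y * k x y)) =
         (LINT y|lborel. b y * (LINT x|lborel. a x * k x y))"
proof -
  note [measurable] = borel_measurable_integrable[OF a] borel_measurable_integrable[OF b]
  have ab: "integrable (lborel \<Otimes>\<^sub>M lborel) (\<lambda>(x, y). a x * b y)"
  proof (rule lborel_pair.Fubini_integrable)
    have "integrable lborel (\<lambda>x. cmod (a x) * (LINT y|lborel. cmod (b y)))"
      using a by (intro integrable_mult_left integrable_norm)
    then show "integrable lborel
        (\<lambda>x. LINT y|lborel. cmod (case (x, y) of (x, y) \<Rightarrow> a x * b y))"
      by (simp add: norm_mult)
  qed (use b in auto)
  have "integrable (lborel \<Otimes>\<^sub>M lborel) (case_prod (\<lambda>x y. a x * b y * k x y))"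
  proof (rule Bochner_Integration.integrable_bound)
    show "integrable (lborel \<Otimes>\<^sub>M lborel) (\<lambda>p. of_real B * (case p of (x, y) \<Rightarrow> a x * b y))"
      using ab by (rule integrable_mult_right)
    show "case_prod (\<lambda>x y. a x * b y * k x y) \<in> borel_measurable (lborel \<Otimes>\<^sub>M lborel)"
      by measurable
    have "0 \<le> B"
      using bound[of 0 0] norm_ge_zero order_trans by blast
    then show "AE p in lborel \<Otimes>\<^sub>M lborel.
        cmod (case_prod (\<lambda>x y. a x * b y * k x y) p) \<le> cmod (of_real B * (case p of (x, y) \<Rightarrow> a x * b y))"
      using bound by (auto simp: norm_mult mult.commute[of B] intro!: AE_I2 mult_left_mono)
  qed
  from lborel_pair.Fubini_integral[OF this] show ?thesis
    by (simp add: mult.left_commute mult.assoc flip: integral_mult_right_zero)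
qed

lemma integrable_bounded_factor:
  fixes a k :: "real \<Rightarrow> complex"
  assumes a: "integrable lborel a" and k: "k \<in> borel_measurable borel"
    and bound: "\<And>x. cmod (k x) \<le> B"
  shows "integrable lborel (\<lambda>x. a x * k x)"
proof (rule Bochner_Integration.integrable_bound)
  show "integrable lborel (\<lambda>x. of_real B * a x)"
    using a by (rule integrable_mult_right)
  show "(\<lambda>x. a x * k x) \<in> borel_measurable lborel"
    using borel_measurable_integrable[OF a] k by simp
  have "0 \<le> B"
    using bound[of 0] norm_ge_zero order_trans by blast
  then show "AE x in lborel. cmod (a x * k x) \<le> cmod (of_real B * a x)"
    using bound by (auto simp: norm_mult mult.commute[of B] intro!: AE_I2 mult_left_mono)
qed

lemma gaussian_integrable: "integrable lborel (\<lambda>v::real. complex_of_real (exp (- v\<^sup>2 / 2)))"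
proof -
  have "integrable lborel (\<lambda>v. sqrt (2 * pi) * std_normal_density v)"
    using integrable_std_normal_moment_abs[of 0] by (intro integrable_mult_right) simp
  then show ?thesis
    by (intro integrable_of_real) (simp add: std_normal_density_def)
qed

text \<open>Up to the factor \<open>sqrt (2 * pi)\<close> the left-hand side is the characteristic
  function of the standard normal distribution.\<close>

lemma gaussian_fourier:
  "(LINT v|lborel. complex_of_real (exp (- v\<^sup>2 / 2)) * exp (\<i> * complex_of_real (v * t))) =
   sqrt (2 * pi) * exp (- t\<^sup>2 / 2)"
proof -
  have "char std_normal_distribution t =
      (LINT v|lborel. std_normal_density v *\<^sub>R exp (\<i> * complex_of_real (t * v)))"
    unfolding char_def by (subst integral_density) auto
  also have "\<dots> = (LINT v|lborel. complex_of_real (1 / sqrt (2 * pi)) *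
      (complex_of_real (exp (- v\<^sup>2 / 2)) * exp (\<i> * complex_of_real (v * t))))"
    by (intro Bochner_Integration.integral_cong)
       (auto simp: std_normal_density_def scaleR_conv_of_real mult.commute[of t])
  also have "\<dots> = complex_of_real (1 / sqrt (2 * pi)) *
      (LINT v|lborel. complex_of_real (exp (- v\<^sup>2 / 2)) * exp (\<i> * complex_of_real (v * t)))"
    by (rule integral_mult_right_zero)
  finally show ?thesis
    by (simp add: char_std_normal_distribution field_simps)
qed

text \<open>Gaussian regularisation of the inversion integral turns it into an average of \<open>g\<close> near \<open>x\<close>.\<close>

lemma fourier_inversion:
  assumes g: "integrable lborel g" and bound: "\<And>x. cmod (g x) \<le> B"
    and F: "integrable lborel (fourier g)" and cont: "isCont g x"
  shows "g x = 1 / (2 * pi) * (LINT \<xi>|lborel. fourier g \<xi> * exp (- (\<i> * complex_of_real (x * \<xi>))))"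
proof -
  define \<gamma> where "\<gamma> v = complex_of_real (exp (- v\<^sup>2 / 2))" for v :: real
  have [measurable]: "g \<in> borel_measurable borel" "fourier g \<in> borel_measurable borel"
    using g F by auto
  have [measurable]: "\<gamma> \<in> borel_measurable borel"
    unfolding \<gamma>_def by measurable
  have \<gamma>_int: "integrable lborel \<gamma>"
    unfolding \<gamma>_def by (rule gaussian_integrable)
  have \<gamma>_fourier: "(LINT v|lborel. \<gamma> v * exp (\<i> * complex_of_real (v * t))) = sqrt (2 * pi) * \<gamma> t" for t
    using gaussian_fourier[of t] by (simp add: \<gamma>_def)
  have \<gamma>_le: "cmod (\<gamma> v) \<le> 1" for v
    by (simp add: \<gamma>_def)
  have \<gamma>_total: "(LINT v|lborel. \<gamma> v) = sqrt (2 * pi)"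
    using \<gamma>_fourier[of 0] by (simp add: \<gamma>_def)
  define \<epsilon> where "\<epsilon> n = 1 / real (Suc n)" for n
  have \<epsilon>_pos: "\<epsilon> n > 0" for n
    by (simp add: \<epsilon>_def)
  have \<epsilon>_lim: "\<epsilon> \<longlonglongrightarrow> 0"
    unfolding \<epsilon>_def using LIMSEQ_inverse_real_of_nat by (simp add: inverse_eq_divide)
  \<comment> \<open>The inversion integral damped by a Gaussian of width \<open>1 / e\<close>. It is
    computed as an average of \<open>g\<close>, and then the damping is removed along
    \<open>e = \<epsilon> n\<close>.\<close>
  define A where "A e = (LINT \<xi>|lborel. \<gamma> (e * \<xi>) * exp (- (\<i> * complex_of_real (x * \<xi>))) * fourier g \<xi>)"
    for e
  \<comment> \<open>Fubini moves the damping onto \<open>g\<close>. The Gaussian is its own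
    transform up to a constant, and the substitution \<open>t = x + e * u\<close> concentrates it at
    \<open>x\<close>.\<close>
  have A: "A e = sqrt (2 * pi) * (LINT u|lborel. g (x + e * u) * \<gamma> u)" if "e > 0" for e
  proof -
    have \<gamma>e: "integrable lborel (\<lambda>\<xi>. \<gamma> (e * \<xi>) * exp (- (\<i> * complex_of_real (x * \<xi>))))"
      using lborel_integrable_real_affine[OF \<gamma>_int, of e 0] that
      by (intro integrable_bounded_factor[where B=1]) auto
    have "A e = (LINT t|lborel. g t * (LINT \<xi>|lborel.
        \<gamma> (e * \<xi>) * exp (- (\<i> * complex_of_real (x * \<xi>))) * exp (\<i> * complex_of_real (t * \<xi>))))"
      unfolding A_def fourier_def
      by (rule Fubini_bounded_kernel[OF \<gamma>e g, where B=1]) auto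
    also have "\<dots> = (LINT t|lborel. g t * (complex_of_real (1/e) * (sqrt (2 * pi) * \<gamma> ((t - x) / e))))"
    proof (intro Bochner_Integration.integral_cong refl arg_cong2[where f="(*)"])
      fix t
      have "(LINT \<xi>|lborel. \<gamma> (e * \<xi>) * exp (- (\<i> * complex_of_real (x * \<xi>))) * exp (\<i> * complex_of_real (t * \<xi>)))
          = (LINT \<xi>|lborel. \<gamma> (e * \<xi>) * exp (\<i> * complex_of_real (\<xi> * (t - x))))"
        by (simp add: exp_minus' exp_diff algebra_simps exp_add[symmetric] flip: exp_minus)
      also have "\<dots> = \<bar>1/e\<bar> *\<^sub>R (LINT v|lborel. \<gamma> v * exp (\<i> * complex_of_real (v * ((t - x) / e))))"
        using that by (subst lborel_integral_real_affine[of "1/e" _ 0]) auto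
      finally show "(LINT \<xi>|lborel. \<gamma> (e * \<xi>) * exp (- (\<i> * complex_of_real (x * \<xi>))) * exp (\<i> * complex_of_real (t * \<xi>)))
          = complex_of_real (1/e) * (sqrt (2 * pi) * \<gamma> ((t - x) / e))"
        using that by (simp only: \<gamma>_fourier) (simp add: scaleR_conv_of_real)
    qed
    also have "\<dots> = \<bar>e\<bar> *\<^sub>R (LINT u|lborel. g (x + e * u) * (complex_of_real (1/e) * (sqrt (2 * pi) * \<gamma> u)))"
      using that by (subst lborel_integral_real_affine[of e _ x]) auto
    also have "\<dots> = \<bar>e\<bar> *\<^sub>R (LINT u|lborel. (complex_of_real (1/e) * sqrt (2 * pi)) * (g (x + e * u) * \<gamma> u))"
      by (simp add: mult_ac)
    also have "\<dots> = sqrt (2 * pi) * (LINT u|lborel. g (x + e * u) * \<gamma> u)"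
      using that by (subst integral_mult_right_zero) (simp add: scaleR_conv_of_real)
    finally show ?thesis .
  qed
  \<comment> \<open>First evaluation of the limit: the damping factor tends to 1 pointwise and is at
    most 1, so integrability of \<open>fourier g\<close> provides the majorant.\<close>
  have "(\<lambda>n. A (\<epsilon> n)) \<longlonglongrightarrow> (LINT \<xi>|lborel. fourier g \<xi> * exp (- (\<i> * complex_of_real (x * \<xi>))))"
    unfolding A_def
  proof (rule integral_dominated_convergence[where w="\<lambda>\<xi>. cmod (fourier g \<xi>)"])
    show "AE \<xi> in lborel. (\<lambda>n. \<gamma> (\<epsilon> n * \<xi>) * exp (- (\<i> * complex_of_real (x * \<xi>))) * fourier g \<xi>)
        \<longlonglongrightarrow> fourier g \<xi> * exp (- (\<i> * complex_of_real (x * \<xi>)))"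
    proof (rule AE_I2)
      fix \<xi>
      have "(\<lambda>n. \<gamma> (\<epsilon> n * \<xi>)) \<longlonglongrightarrow> complex_of_real (exp (- (0 * \<xi>)\<^sup>2 / 2))"
        unfolding \<gamma>_def by (intro tendsto_intros \<epsilon>_lim) auto
      then have "(\<lambda>n. \<gamma> (\<epsilon> n * \<xi>) * exp (- (\<i> * complex_of_real (x * \<xi>))) * fourier g \<xi>)
        \<longlonglongrightarrow> complex_of_real (exp (- (0 * \<xi>)\<^sup>2 / 2)) * exp (- (\<i> * complex_of_real (x * \<xi>))) * fourier g \<xi>"
        by (intro tendsto_intros)
      then show "(\<lambda>n. \<gamma> (\<epsilon> n * \<xi>) * exp (- (\<i> * complex_of_real (x * \<xi>))) * fourier g \<xi>)
        \<longlonglongrightarrow> fourier g \<xi> * exp (- (\<i> * complex_of_real (x * \<xi>)))"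
        by (simp add: mult.commute)
    qed
    show "AE \<xi> in lborel. cmod (\<gamma> (\<epsilon> n * \<xi>) * exp (- (\<i> * complex_of_real (x * \<xi>))) * fourier g \<xi>) \<le> cmod (fourier g \<xi>)" for n
      using \<gamma>_le by (auto simp: norm_mult intro!: mult_left_le_one_le)
  qed (use F in auto)
  \<comment> \<open>Second evaluation: continuity at \<open>x\<close> gives the pointwise limit, and
    boundedness of \<open>g\<close> gives the majorant \<open>B * cmod (\<gamma> u)\<close>.\<close>
  moreover have "(\<lambda>n. A (\<epsilon> n)) \<longlonglongrightarrow> sqrt (2 * pi) * (LINT u|lborel. g x * \<gamma> u)"
    unfolding A[OF \<epsilon>_pos]
  proof (rule tendsto_mult[OF tendsto_const],
      rule integral_dominated_convergence[where w="\<lambda>u. B * cmod (\<gamma> u)"]; (intro AE_I2)?)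
    fix u
    have "(\<lambda>n. x + \<epsilon> n * u) \<longlonglongrightarrow> x + 0 * u"
      by (intro tendsto_intros \<epsilon>_lim)
    then have "(\<lambda>n. g (x + \<epsilon> n * u)) \<longlonglongrightarrow> g x"
      using cont by (intro isCont_tendsto_compose[of x g]) auto
    then show "(\<lambda>n. g (x + \<epsilon> n * u) * \<gamma> u) \<longlonglongrightarrow> g x * \<gamma> u"
      by (intro tendsto_intros)
    show "cmod (g (x + \<epsilon> n * u) * \<gamma> u) \<le> B * cmod (\<gamma> u)" for n
      using bound by (auto simp: norm_mult intro!: mult_right_mono)
  qed (use \<gamma>_int in auto)
  ultimately have "(LINT \<xi>|lborel. fourier g \<xi> * exp (- (\<i> * complex_of_real (x * \<xi>)))) =
      sqrt (2 * pi) * (LINT u|lborel. g x * \<gamma> u)"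
    by (rule LIMSEQ_unique)
  also have "\<dots> = complex_of_real (sqrt (2 * pi) * sqrt (2 * pi)) * g x"
    by (subst integral_mult_right_zero, subst \<gamma>_total) (simp only: of_real_mult mult_ac)
  also have "\<dots> = complex_of_real (2 * pi) * g x"
    by (simp only: real_sqrt_mult_self) simp
  finally show ?thesis
    by simp
qed

section \<open>Principal values through the Fourier transform\<close>

text \<open>The weight is at most 1 on [-1, 1] and at most
  \<open>\<bar>x\<bar> powr (-2 * s)\<close> elsewhere; the latter is integrable at infinity because
  2s > 1. The two tails are \<open>t x\<close> and \<open>t (-x)\<close>.\<close>

lemma integrable_bessel_weight:
  assumes "1/2 < s"
  shows "integrable lborel (\<lambda>x::real. (1 + x\<^sup>2) powr (-s))"
proof -
  define t where "t x = indicator {1..} x * x powr (-2 * s)" for x :: real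
  have "(\<lambda>x. x powr (-2 * s)) integrable_on {1..}"
    using has_integral_powr_to_inf[of "-2 * s" 1] assms by (auto simp: integrable_on_def)
  then have "(\<lambda>x. x powr (-2 * s)) absolutely_integrable_on {1..}"
    by (rule nonnegative_absolutely_integrable_1) auto
  then have t: "integrable lborel t"
    unfolding set_integrable_def t_def by (subst (asm) integrable_completion) auto
  have "integrable lborel (\<lambda>x. indicator {-1..1} x + t x + t (-x))"
    using t lborel_integrable_real_affine[OF t, of "-1" 0]
    by (intro Bochner_Integration.integrable_add) auto
  then show ?thesis
  proof (rule Bochner_Integration.integrable_bound)
    have tail: "(1 + x\<^sup>2) powr (-s) \<le> y powr (-2 * s)" if "1 \<le> y" "y\<^sup>2 = x\<^sup>2" for x y :: real
    proof -
      have "(1 + x\<^sup>2) powr (-s) \<le> (y\<^sup>2) powr (-s)"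
        using that assms by (intro powr_mono2') auto
      also have "\<dots> = y powr (-2 * s)"
        using that powr_powr[of y 2 "-s"] by simp
      finally show ?thesis .
    qed
    have le_1: "(1 + x\<^sup>2) powr (-s) \<le> 1" for x :: real
      using powr_mono2'[of "-s" 1 "1 + x\<^sup>2"] assms by simp
    show "AE x in lborel. norm ((1 + x\<^sup>2) powr (-s)) \<le> norm (indicator {-1..1} x + t x + t (-x))"
    proof (rule AE_I2)
      fix x :: real
      consider "x \<in> {-1..1}" | "x > 1" | "x < -1" by force
      then show "norm ((1 + x\<^sup>2) powr (-s)) \<le> norm (indicator {-1..1} x + t x + t (-x))"
      proof cases
        case 1
        then have "norm (indicator {-1..1} x + t x + t (-x)) \<ge> 1"
          by (auto simp: t_def indicator_def)
        then show ?thesis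
          using le_1[of x] by simp
      next
        case 2
        then show ?thesis
          using tail[of x x] by (auto simp: t_def)
      next
        case 3
        then show ?thesis
          using tail[of "-x" x] by (auto simp: t_def)
      qed
    qed
  qed auto
qed

text \<open>Up to null sets the interval is (0, R) minus (0, \<epsilon>), and on each of these
  scaling by \<open>\<bar>\<xi>\<bar>\<close> produces a value of \<open>Si\<close>, with the sign
  of \<xi> in front.\<close>

lemma integral_sin_divide_annulus:
  assumes "0 < \<epsilon>" "\<epsilon> \<le> R"
  shows "(LINT u|lborel. indicator {\<epsilon><..R} u * (sin (u * \<xi>) / u)) =
    sgn \<xi> * (Si (R * \<bar>\<xi>\<bar>) - Si (\<epsilon> * \<bar>\<xi>\<bar>))"
proof -
  have *: "(LINT u|lborel. indicator {0<..<T} u * (sin (u * \<xi>) / u)) = sgn \<xi> * Si (T * \<bar>\<xi>\<bar>)"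
    "integrable lborel (\<lambda>u. indicator {0<..<T} u * (sin (u * \<xi>) / u))" if "T > 0" for T
    using LBINT_I0c_sin_scale_divide[of T \<xi>] integrable_sinc'[of T \<xi>] that
    by (auto simp: interval_lebesgue_integral_def interval_lebesgue_integrable_def
        set_lebesgue_integral_def set_integrable_def zero_ereal_def)
  have "(LINT u|lborel. indicator {\<epsilon><..R} u * (sin (u * \<xi>) / u)) =
    (LINT u|lborel. indicator {0<..<R} u * (sin (u * \<xi>) / u) - indicator {0<..<\<epsilon>} u * (sin (u * \<xi>) / u))"
    using AE_lborel_singleton[of \<epsilon>] AE_lborel_singleton[of R] assms
    by (intro integral_cong_AE) (auto elim!: eventually_elim2 simp: indicator_def)
  also have "\<dots> = sgn \<xi> * (Si (R * \<bar>\<xi>\<bar>) - Si (\<epsilon> * \<bar>\<xi>\<bar>))"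
    using assms by (subst Bochner_Integration.integral_diff) (use * in \<open>auto simp: right_diff_distrib\<close>)
  finally show ?thesis .
qed

text \<open>Inserting the inversion formula for \<open>g\<close> and exchanging the integrals leaves
  a truncated integral of sin(u \<xi>)/u, whose limit is (\<pi>/2) \<open>sgn \<xi>\<close>.
  Inversion is asked for only almost everywhere, since \<open>g\<close> enters under an integral,
  while the conclusion holds at every single \<open>y\<close>.\<close>

lemma principal_value_fourier:
  fixes g G :: "real \<Rightarrow> complex"
  assumes g: "integrable lborel g" and supp: "\<And>x. x \<notin> {a..b} \<Longrightarrow> g x = 0"
    and G: "integrable lborel G"
    and inv: "AE x in lborel. g x =
      1 / (2 * pi) * (LINT \<xi>|lborel. G \<xi> * exp (- (\<i> * complex_of_real (x * \<xi>))))"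
  shows "((\<lambda>\<epsilon>. LINT x:{x \<in> {a..b}. \<epsilon> < \<bar>x - y\<bar>}|lborel. g x / complex_of_real (x - y)) \<longlongrightarrow>
    - (\<i> / 2) * (LINT \<xi>|lborel. G \<xi> * exp (- (\<i> * complex_of_real (y * \<xi>))) * complex_of_real (sgn \<xi>))) (at_right 0)"
proof -
  define h where "h x = 1 / (2 * pi) * (LINT \<xi>|lborel. G \<xi> * exp (- (\<i> * complex_of_real (x * \<xi>))))"
    for x :: real
  define G' where "G' \<xi> = G \<xi> * exp (- (\<i> * complex_of_real (y * \<xi>)))" for \<xi>
  define T where "T \<epsilon> = (LINT x:{x \<in> {a..b}. \<epsilon> < \<bar>x - y\<bar>}|lborel. g x / complex_of_real (x - y))" for \<epsilon>
  have [measurable]: "g \<in> borel_measurable borel" "G \<in> borel_measurable borel"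
    using g G by auto
  have [measurable]: "h \<in> borel_measurable borel"
    unfolding h_def by measurable
  have G_exp: "integrable lborel (\<lambda>\<xi>. G \<xi> * exp (- (\<i> * complex_of_real (x * \<xi>))))" for x
    by (rule integrable_bounded_factor[OF G, where B=1]) auto
  have G': "integrable lborel G'"
    unfolding G'_def by (rule G_exp)
  have [measurable]: "G' \<in> borel_measurable borel"
    using G' by auto
  have h_bound: "cmod (h x) \<le> 1 / (2 * pi) * (LINT \<xi>|lborel. cmod (G \<xi>))" for x
  proof -
    have "cmod (LINT \<xi>|lborel. G \<xi> * exp (- (\<i> * complex_of_real (x * \<xi>)))) \<le> (LINT \<xi>|lborel. cmod (G \<xi>))"
      using integral_norm_bound[of lborel "\<lambda>\<xi>. G \<xi> * exp (- (\<i> * complex_of_real (x * \<xi>)))"]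
      by (simp add: norm_mult)
    then show ?thesis
      by (simp add: h_def norm_mult norm_divide divide_right_mono)
  qed
  obtain BS where BS: "\<And>t. \<bar>Si t\<bar> \<le> BS"
    using bounded_Si by blast
  text \<open>
    The integrand vanishes for \<open>\<bar>x - y\<bar> > R\<close>, so \<open>R\<close> is arbitrary; the outer cutoff makes
    Fubini applicable and is then sent to infinity.
  \<close>
  have T_annulus: "T \<epsilon> = - (\<i> / pi) * (LINT \<xi>|lborel. G' \<xi> *
      complex_of_real (sgn \<xi> * (Si (R * \<bar>\<xi>\<bar>) - Si (\<epsilon> * \<bar>\<xi>\<bar>))))"
    if \<epsilon>: "0 < \<epsilon>" "\<epsilon> \<le> R" and R: "{a..b} \<subseteq> {y - R..y + R}" for \<epsilon> R
  proof -
    \<comment> \<open>The kernel 1/u on the right half of the annulus only. On the left half 1/u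
      equals \<open>- k (-u)\<close>, so reflecting \<open>u\<close> turns the symmetric truncation
      into the difference \<open>h (y + u) - h (y - u)\<close>.\<close>
    define k where "k u = complex_of_real (indicator {\<epsilon><..R} u / u)" for u
    have [measurable]: "k \<in> borel_measurable borel"
      unfolding k_def by measurable
    have k: "integrable lborel k"
    proof (rule Bochner_Integration.integrable_bound)
      show "integrable lborel (\<lambda>u. indicator {\<epsilon><..R} u * (1 / \<epsilon>))"
        using \<epsilon> by (intro integrable_mult_left integrable_real_indicator) (auto simp: emeasure_lborel_Ioc)
      show "AE u in lborel. norm (k u) \<le> norm (indicator {\<epsilon><..R} u * (1 / \<epsilon>))"
        using \<epsilon> by (intro AE_I2) (auto simp: k_def indicator_def field_simps norm_divide)
    qed measurable
    have kh: "integrable lborel (\<lambda>u. k u * h (c u))" if "c \<in> borel_measurable borel" for c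
      using that by (intro integrable_bounded_factor[OF k _ h_bound]) measurable
    have kh_minus: "integrable lborel (\<lambda>u. k (-u) * h (y + u))"
      using lborel_integrable_real_affine[OF kh[of "\<lambda>u. y - u"], of "-1" 0] by simp
    have "T \<epsilon> = (LINT x|lborel. indicator {\<epsilon><..R} \<bar>x - y\<bar> *\<^sub>R (h x / complex_of_real (x - y)))"
      unfolding T_def set_lebesgue_integral_def
    proof (rule integral_cong_AE)
      show "AE x in lborel. indicator {x \<in> {a..b}. \<epsilon> < \<bar>x - y\<bar>} x *\<^sub>R (g x / complex_of_real (x - y)) =
          indicator {\<epsilon><..R} \<bar>x - y\<bar> *\<^sub>R (h x / complex_of_real (x - y))"
        using inv
      proof eventually_elim
        case (elim x)
        then have "g x = h x"
          by (simp add: h_def)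
        moreover have "\<bar>x - y\<bar> \<le> R" if "x \<in> {a..b}"
          using R that by (auto simp: subset_iff abs_le_iff)
        ultimately show ?case
          using supp[of x] by (auto simp: indicator_def)
      qed
    qed measurable
    also have "\<dots> = (LINT u|lborel. indicator {\<epsilon><..R} \<bar>u\<bar> *\<^sub>R (h (y + u) / complex_of_real u))"
      by (subst lborel_integral_real_affine[of 1 _ y]) auto
    also have "\<dots> = (LINT u|lborel. k u * h (y + u) - k (-u) * h (y + u))"
      using \<epsilon> by (intro Bochner_Integration.integral_cong) (auto simp: k_def indicator_def)
    also have "\<dots> = (LINT u|lborel. k u * h (y + u)) - (LINT u|lborel. k (-u) * h (y + u))"
      using kh_minus by (intro Bochner_Integration.integral_diff kh) auto
    also have "(LINT u|lborel. k (-u) * h (y + u)) = (LINT u|lborel. k u * h (y - u))"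
      by (subst lborel_integral_real_affine[of "-1" _ 0]) auto
    also have "(LINT u|lborel. k u * h (y + u)) - \<dots> = (LINT u|lborel. k u * h (y + u) - k u * h (y - u))"
      by (intro Bochner_Integration.integral_diff[symmetric] kh) auto
    \<comment> \<open>The symmetric difference of the exponentials is -2i sin(u \<xi>) times the
      phase at \<open>y\<close>, which is stored in \<open>G'\<close>. Together with the factor
      1/(2\<pi>) of the inversion formula this gives -i/\<pi>.\<close>
    also have "\<dots> = (LINT u|lborel. - (\<i> / pi) * (k u * (LINT \<xi>|lborel. G' \<xi> * complex_of_real (sin (u * \<xi>)))))"
    proof (intro Bochner_Integration.integral_cong refl)
      fix u :: real
      have "h (y + u) - h (y - u) = 1 / (2 * pi) * (LINT \<xi>|lborel.
          G \<xi> * exp (- (\<i> * complex_of_real ((y + u) * \<xi>))) - G \<xi> * exp (- (\<i> * complex_of_real ((y - u) * \<xi>))))"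
        unfolding h_def by (subst Bochner_Integration.integral_diff[OF G_exp G_exp]) (simp add: algebra_simps)
      also have "\<dots> = 1 / (2 * pi) * (LINT \<xi>|lborel. (- 2 * \<i>) * (G' \<xi> * complex_of_real (sin (u * \<xi>))))"
      proof -
        have "G \<xi> * exp (- (\<i> * complex_of_real ((y + u) * \<xi>))) - G \<xi> * exp (- (\<i> * complex_of_real ((y - u) * \<xi>)))
            = (- 2 * \<i>) * (G' \<xi> * complex_of_real (sin (u * \<xi>)))" for \<xi>
        proof -
          have "exp (- (\<i> * complex_of_real ((y + u) * \<xi>))) - exp (- (\<i> * complex_of_real ((y - u) * \<xi>)))
              = exp (- (\<i> * complex_of_real (y * \<xi>))) *
                (exp (- (\<i> * complex_of_real (u * \<xi>))) - exp (\<i> * complex_of_real (u * \<xi>)))"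
            unfolding right_diff_distrib exp_add[symmetric]
            by (intro arg_cong2[where f="(-)"] arg_cong[where f=exp]) (simp_all add: algebra_simps)
          also have "exp (- (\<i> * complex_of_real (u * \<xi>))) - exp (\<i> * complex_of_real (u * \<xi>)) =
              - 2 * \<i> * complex_of_real (sin (u * \<xi>))"
            by (simp add: complex_eq_iff Re_exp Im_exp)
          finally show ?thesis
            by (simp add: G'_def mult_ac flip: right_diff_distrib)
        qed
        then show ?thesis
          by simp
      qed
      also have "\<dots> = - (\<i> / pi) * (LINT \<xi>|lborel. G' \<xi> * complex_of_real (sin (u * \<xi>)))"
        by (subst integral_mult_right_zero) simp
      finally show "k u * h (y + u) - k u * h (y - u) =
          - (\<i> / pi) * (k u * (LINT \<xi>|lborel. G' \<xi> * complex_of_real (sin (u * \<xi>))))"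
        by (simp add: mult.left_commute flip: right_diff_distrib)
    qed
    also have "\<dots> = - (\<i> / pi) * (LINT u|lborel. k u * (LINT \<xi>|lborel. G' \<xi> * complex_of_real (sin (u * \<xi>))))"
      by (rule integral_mult_right_zero)
    also have "(LINT u|lborel. k u * (LINT \<xi>|lborel. G' \<xi> * complex_of_real (sin (u * \<xi>)))) =
        (LINT \<xi>|lborel. G' \<xi> * (LINT u|lborel. k u * complex_of_real (sin (u * \<xi>))))"
      by (rule Fubini_bounded_kernel[OF k G', where B=1]) auto
    also have "(\<lambda>\<xi>. LINT u|lborel. k u * complex_of_real (sin (u * \<xi>))) =
        (\<lambda>\<xi>. complex_of_real (sgn \<xi> * (Si (R * \<bar>\<xi>\<bar>) - Si (\<epsilon> * \<bar>\<xi>\<bar>))))"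
      unfolding integral_sin_divide_annulus[OF \<epsilon>, symmetric]
      by (simp add: k_def flip: integral_complex_of_real)
    finally show ?thesis .
  qed
  have T_outer: "T \<epsilon> = - (\<i> / pi) * (LINT \<xi>|lborel. G' \<xi> *
      complex_of_real (sgn \<xi> * (pi / 2 - Si (\<epsilon> * \<bar>\<xi>\<bar>))))" if \<epsilon>: "0 < \<epsilon>" for \<epsilon>
  proof -
    \<comment> \<open>The first three summands make \<open>R n\<close> at least \<epsilon> and large
      enough for the interval around \<open>y\<close> to contain \<open>{a..b}\<close>; the last one
      sends it to infinity. \<open>T \<epsilon>\<close> itself is independent of \<open>n\<close>,
      so its value is the limit.\<close>
    define R where "R n = \<epsilon> + \<bar>a - y\<bar> + \<bar>b - y\<bar> + real n" for n
    have R: "\<epsilon> \<le> R n" "{a..b} \<subseteq> {y - R n..y + R n}" for n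
      using \<epsilon> by (auto simp: R_def)
    have R_top: "filterlim R at_top sequentially"
      unfolding R_def by (intro filterlim_tendsto_add_at_top[OF tendsto_const] filterlim_real_sequentially)
    have "(\<lambda>n. - (\<i> / pi) * (LINT \<xi>|lborel. G' \<xi> * complex_of_real (sgn \<xi> * (Si (R n * \<bar>\<xi>\<bar>) - Si (\<epsilon> * \<bar>\<xi>\<bar>)))))
      \<longlonglongrightarrow> - (\<i> / pi) * (LINT \<xi>|lborel. G' \<xi> * complex_of_real (sgn \<xi> * (pi / 2 - Si (\<epsilon> * \<bar>\<xi>\<bar>))))"
    proof (rule tendsto_mult[OF tendsto_const],
        rule integral_dominated_convergence[where w="\<lambda>\<xi>. cmod (G' \<xi>) * (2 * BS)"]; (intro AE_I2)?)
      fix \<xi> :: real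
      have "(\<lambda>n. Si (R n * \<bar>\<xi>\<bar>)) \<longlonglongrightarrow> pi / 2" if "\<xi> \<noteq> 0"
        using that by (intro filterlim_compose[OF Si_at_top] filterlim_at_top_mult_tendsto_pos[OF tendsto_const _ R_top]) auto
      \<comment> \<open>At \<xi> = 0 the sine integral stays at 0 instead of tending to \<pi>/2, but
        there the factor \<open>sgn \<xi>\<close> vanishes.\<close>
      then have "(\<lambda>n. sgn \<xi> * (Si (R n * \<bar>\<xi>\<bar>) - Si (\<epsilon> * \<bar>\<xi>\<bar>))) \<longlonglongrightarrow> sgn \<xi> * (pi / 2 - Si (\<epsilon> * \<bar>\<xi>\<bar>))"
        by (cases "\<xi> = 0") (simp, intro tendsto_mult tendsto_diff tendsto_const, simp)
      then show "(\<lambda>n. G' \<xi> * complex_of_real (sgn \<xi> * (Si (R n * \<bar>\<xi>\<bar>) - Si (\<epsilon> * \<bar>\<xi>\<bar>)))) \<longlonglongrightarrow>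
          G' \<xi> * complex_of_real (sgn \<xi> * (pi / 2 - Si (\<epsilon> * \<bar>\<xi>\<bar>)))"
        by (rule tendsto_mult[OF tendsto_const tendsto_of_real])
      show "cmod (G' \<xi> * complex_of_real (sgn \<xi> * (Si (R n * \<bar>\<xi>\<bar>) - Si (\<epsilon> * \<bar>\<xi>\<bar>)))) \<le> cmod (G' \<xi>) * (2 * BS)" for n
      proof -
        have "\<bar>sgn \<xi> * (Si (R n * \<bar>\<xi>\<bar>) - Si (\<epsilon> * \<bar>\<xi>\<bar>))\<bar> \<le> 2 * BS"
          using BS[of "R n * \<bar>\<xi>\<bar>"] BS[of "\<epsilon> * \<bar>\<xi>\<bar>"] by (auto simp: abs_mult abs_sgn_eq)
        then show ?thesis
          unfolding norm_mult norm_of_real by (intro mult_left_mono) auto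
      qed
    qed (use G' in auto)
    moreover have "(\<lambda>n. - (\<i> / pi) * (LINT \<xi>|lborel. G' \<xi> * complex_of_real (sgn \<xi> * (Si (R n * \<bar>\<xi>\<bar>) - Si (\<epsilon> * \<bar>\<xi>\<bar>)))))
      \<longlonglongrightarrow> T \<epsilon>"
      using T_annulus[OF \<epsilon> R] by simp
    ultimately show ?thesis
      by (rule LIMSEQ_unique[rotated])
  qed
  \<comment> \<open>The inner cutoff goes to 0. Dominated convergence is applied along sequences,
    and \<open>Si\<close> is continuous with \<open>Si 0 = 0\<close>. The constant of the claim is
    (-i/\<pi>)(\<pi>/2) = -i/2.\<close>
  have "(T \<longlongrightarrow> - (\<i> / pi) * (LINT \<xi>|lborel. G' \<xi> * complex_of_real (sgn \<xi> * (pi / 2 - 0)))) (at_right 0)"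
  proof (rule tendsto_at_right_sequentially[of 0 1])
    fix S :: "nat \<Rightarrow> real"
    assume S: "\<And>n. 0 < S n" "S \<longlonglongrightarrow> 0"
    show "(\<lambda>n. T (S n)) \<longlonglongrightarrow> - (\<i> / pi) * (LINT \<xi>|lborel. G' \<xi> * complex_of_real (sgn \<xi> * (pi / 2 - 0)))"
      unfolding T_outer[OF S(1)]
    proof (rule tendsto_mult[OF tendsto_const],
        rule integral_dominated_convergence[where w="\<lambda>\<xi>. cmod (G' \<xi>) * (pi / 2 + BS)"]; (intro AE_I2)?)
      fix \<xi> :: real
      have "(\<lambda>n. Si (S n * \<bar>\<xi>\<bar>)) \<longlonglongrightarrow> Si (0 * \<bar>\<xi>\<bar>)"
        by (intro isCont_tendsto_compose[OF isCont_Si] tendsto_intros S)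
      moreover have "Si 0 = 0"
        by (simp add: Si_def zero_ereal_def)
      ultimately show "(\<lambda>n. G' \<xi> * complex_of_real (sgn \<xi> * (pi / 2 - Si (S n * \<bar>\<xi>\<bar>)))) \<longlonglongrightarrow>
          G' \<xi> * complex_of_real (sgn \<xi> * (pi / 2 - 0))"
        by (intro tendsto_mult tendsto_const tendsto_of_real tendsto_diff) simp
      show "cmod (G' \<xi> * complex_of_real (sgn \<xi> * (pi / 2 - Si (S n * \<bar>\<xi>\<bar>)))) \<le> cmod (G' \<xi>) * (pi / 2 + BS)" for n
      proof -
        have "\<bar>sgn \<xi> * (pi / 2 - Si (S n * \<bar>\<xi>\<bar>))\<bar> \<le> pi / 2 + BS"
        proof -
          have "\<bar>pi / 2 - Si (S n * \<bar>\<xi>\<bar>)\<bar> \<le> pi / 2 + BS"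
            using BS[of "S n * \<bar>\<xi>\<bar>"] pi_gt_zero by linarith
          moreover from this have "0 \<le> pi / 2 + BS"
            by linarith
          ultimately show ?thesis
            by (auto simp: abs_mult abs_sgn_eq)
        qed
        then show ?thesis
          unfolding norm_mult norm_of_real by (intro mult_left_mono) auto
      qed
    qed (use G' in auto)
  qed auto
  also have "(LINT \<xi>|lborel. G' \<xi> * complex_of_real (sgn \<xi> * (pi / 2 - 0))) =
      (LINT \<xi>|lborel. complex_of_real (pi / 2) * (G' \<xi> * complex_of_real (sgn \<xi>)))"
    by (simp add: mult_ac)
  also have "\<dots> = complex_of_real (pi / 2) * (LINT \<xi>|lborel. G' \<xi> * complex_of_real (sgn \<xi>))"
    by (rule integral_mult_right_zero)
  finally show ?thesis
    by (simp add: T_def G'_def)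
qed

section \<open>Fourier transforms of truncated functions\<close>

lemma zero_ext_indicator: "zero_ext A f x = indicator A x *\<^sub>R f x"
  by (simp add: zero_ext_def)

lemma integrable_zero_ext:
  assumes "continuous_on {a..b} f"
  shows "integrable lborel (zero_ext {a..b} f)"
  using borel_integrable_compact[of "{a..b}" f] assms by (simp add: zero_ext_indicator[abs_def])

lemma zero_ext_bounded:
  assumes "continuous_on {a..b} f"
  obtains B where "\<And>x. cmod (zero_ext {a..b} f x) \<le> B"
proof -
  have "bounded (f ` {a..b})"
    using assms by (intro compact_imp_bounded compact_continuous_image) auto
  then obtain B where "\<And>x. x \<in> {a..b} \<Longrightarrow> cmod (f x) \<le> B" "B > 0"
    by (force simp: bounded_pos)
  then show thesis
    by (intro that[of B]) (auto simp: zero_ext_def)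
qed

lemma fourier_integrand_integrable:
  assumes "integrable lborel g"
  shows "integrable lborel (\<lambda>x. g x * exp (\<i> * complex_of_real (x * \<xi>)))"
  by (rule integrable_bounded_factor[OF assms, where B=1]) auto

lemma fourier_diff:
  assumes "integrable lborel g" "integrable lborel h"
  shows "fourier (\<lambda>x. g x - h x) \<xi> = fourier g \<xi> - fourier h \<xi>"
  unfolding fourier_def left_diff_distrib
  by (intro Bochner_Integration.integral_diff fourier_integrand_integrable assms)

lemma borel_measurable_fourier:
  assumes "integrable lborel g"
  shows "fourier g \<in> borel_measurable borel"
proof -
  have [measurable]: "g \<in> borel_measurable borel"
    using assms by auto
  show ?thesis
    unfolding fourier_def by measurable
qed

lemma norm_fourier_le: "cmod (fourier g \<xi>) \<le> (LINT x|lborel. cmod (g x))"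
  unfolding fourier_def
  using integral_norm_bound[of lborel "\<lambda>x. g x * exp (\<i> * complex_of_real (x * \<xi>))"]
  by (simp add: norm_mult)

text \<open>Integration by parts: the fundamental theorem of calculus for \<open>u\<close> times the
  exponential. The boundary terms account for the jumps of the zero extension at the
  endpoints.\<close>

lemma fourier_zero_ext_deriv:
  assumes "a \<le> b"
    and deriv: "\<And>x. x \<in> {a..b} \<Longrightarrow> (u has_vector_derivative u' x) (at x within {a..b})"
    and cont: "continuous_on {a..b} u'"
  shows "fourier (zero_ext {a..b} u') \<xi> =
    u b * exp (\<i> * complex_of_real (b * \<xi>)) - u a * exp (\<i> * complex_of_real (a * \<xi>))
      - \<i> * complex_of_real \<xi> * fourier (zero_ext {a..b} u) \<xi>"
proof -
  let ?e = "\<lambda>x. exp (\<i> * complex_of_real (x * \<xi>))"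
  have cont_u: "continuous_on {a..b} u"
    using deriv by (intro continuous_on_vector_derivative)
  have e: "(?e has_vector_derivative ?e x * (\<i> * complex_of_real \<xi>)) (at x within {a..b})" for x
    by (auto intro!: derivative_eq_intros has_vector_derivative_real_field
        simp: has_vector_derivative_complex_iff Re_exp Im_exp has_real_derivative_iff_has_vector_derivative[symmetric])
  note z_int = integrable_zero_ext[OF cont, THEN fourier_integrand_integrable, of \<xi>]
    integrable_zero_ext[OF cont_u, THEN fourier_integrand_integrable, of \<xi>]
  have "(LINT x|lborel. indicator {a..b} x *\<^sub>R (u x * (?e x * (\<i> * complex_of_real \<xi>)) + u' x * ?e x)) = u b * ?e b - u a * ?e a"
    by (intro integral_FTC_Icc assms has_vector_derivative_mult deriv e continuous_intros cont_u) auto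
  also have "(\<lambda>x. indicator {a..b} x *\<^sub>R (u x * (?e x * (\<i> * complex_of_real \<xi>)) + u' x * ?e x)) =
     (\<lambda>x. (\<i> * complex_of_real \<xi>) * (zero_ext {a..b} u x * ?e x) + zero_ext {a..b} u' x * ?e x)"
    by (auto simp: zero_ext_def indicator_def algebra_simps)
  also have "integral\<^sup>L lborel \<dots> = (\<i> * complex_of_real \<xi>) * fourier (zero_ext {a..b} u) \<xi> + fourier (zero_ext {a..b} u') \<xi>"
    unfolding fourier_def
    by (subst Bochner_Integration.integral_add) (use z_int in \<open>auto intro!: integrable_mult_right\<close>)
  finally show ?thesis
    by (simp add: algebra_simps)
qed

text \<open>Two integrations by parts. The first has no boundary terms because \<open>\<phi>\<close>
  vanishes at the endpoints; those of the second are bounded in \<xi>. Since \<open>\<phi>'\<close>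
  may be nonzero at the endpoints, quadratic decay is what can be expected in general.\<close>

lemma fourier_zero_ext_decay:
  assumes "a \<le> b"
    and \<phi>: "\<And>x. x \<in> {a..b} \<Longrightarrow> (\<phi> has_vector_derivative \<phi>' x) (at x within {a..b})"
    and \<phi>': "\<And>x. x \<in> {a..b} \<Longrightarrow> (\<phi>' has_vector_derivative \<phi>'' x) (at x within {a..b})"
    and cont: "continuous_on {a..b} \<phi>''"
    and zero: "\<phi> a = 0" "\<phi> b = 0"
  obtains C where "\<And>\<xi>. (1 + \<xi>\<^sup>2) * cmod (fourier (zero_ext {a..b} \<phi>) \<xi>) \<le> C"
proof
  let ?z = "zero_ext {a..b}"
  define C where "C = (LINT x|lborel. cmod (?z \<phi> x)) + cmod (\<phi>' b) + cmod (\<phi>' a) + (LINT x|lborel. cmod (?z \<phi>'' x))"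
  fix \<xi> :: real
  have cont': "continuous_on {a..b} \<phi>'"
    using \<phi>' by (intro continuous_on_vector_derivative)
  let ?B = "\<phi>' b * exp (\<i> * complex_of_real (b * \<xi>))" and ?A = "\<phi>' a * exp (\<i> * complex_of_real (a * \<xi>))"
  have "fourier (?z \<phi>'') \<xi> = ?B - ?A - \<xi>\<^sup>2 * fourier (?z \<phi>) \<xi>"
    using fourier_zero_ext_deriv[OF \<open>a \<le> b\<close> \<phi>' cont, of \<xi>] fourier_zero_ext_deriv[OF \<open>a \<le> b\<close> \<phi> cont', of \<xi>]
    by (simp add: zero power2_eq_square algebra_simps)
  then have "complex_of_real (1 + \<xi>\<^sup>2) * fourier (?z \<phi>) \<xi> = fourier (?z \<phi>) \<xi> + ?B - ?A - fourier (?z \<phi>'') \<xi>"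
    by (simp add: algebra_simps)
  then have "cmod (complex_of_real (1 + \<xi>\<^sup>2) * fourier (?z \<phi>) \<xi>) \<le> cmod (fourier (?z \<phi>) \<xi>) + cmod ?B + cmod ?A + cmod (fourier (?z \<phi>'') \<xi>)"
    by (smt (verit) norm_triangle_ineq norm_triangle_ineq4)
  also have "\<dots> \<le> C"
    unfolding C_def by (intro add_mono norm_fourier_le) (auto simp: norm_mult)
  finally show "(1 + \<xi>\<^sup>2) * cmod (fourier (?z \<phi>) \<xi>) \<le> C"
    by (simp only: norm_mult norm_of_real) simp
qed

text \<open>Derivatives within the union restrict to each interval, and one pair
  \<open>\<phi>'\<close>, \<open>\<phi>''\<close> serves all intervals. Two derivatives match the
  two integrations by parts; continuity of the second comes from the existence of a third.\<close>

lemma C0_infE: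
  assumes "\<phi> \<in> C0_inf \<alpha> \<beta>"
  obtains \<phi>' \<phi>'' where
    "\<And>j x. x \<in> {\<alpha> j..\<beta> j} \<Longrightarrow> (\<phi> has_vector_derivative \<phi>' x) (at x within {\<alpha> j..\<beta> j})"
    "\<And>j x. x \<in> {\<alpha> j..\<beta> j} \<Longrightarrow> (\<phi>' has_vector_derivative \<phi>'' x) (at x within {\<alpha> j..\<beta> j})"
    "\<And>j. continuous_on {\<alpha> j..\<beta> j} \<phi>''" "\<And>j. \<phi> (\<alpha> j) = 0" "\<And>j. \<phi> (\<beta> j) = 0"
proof -
  from assms obtain D :: "nat \<Rightarrow> real \<Rightarrow> complex" where "D 0 = \<phi>"
    and D: "\<And>m x. x \<in> interval_union \<alpha> \<beta> \<Longrightarrow>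
      (D m has_vector_derivative D (Suc m) x) (at x within interval_union \<alpha> \<beta>)"
    by (auto simp: C0_inf_def smooth_within_def)
  have "(D m has_vector_derivative D (Suc m) x) (at x within {\<alpha> j..\<beta> j})" if "x \<in> {\<alpha> j..\<beta> j}" for m j x
    using that by (intro has_vector_derivative_within_subset[OF D]) (auto simp: interval_union_def)
  then show thesis
    using assms \<open>D 0 = \<phi>\<close>
    by (intro that[of "D 1" "D 2"] continuous_on_vector_derivative[of _ _ "D 3"])
       (auto simp: C0_inf_def eval_nat_numeral)
qed

text \<open>With t the modulus of the transform and w the weight, t \<le> t^2 w + 1/w: either t w
  \<le> 1, or t \<le> t (t w). This pointwise bound stands in for Cauchy-Schwarz, and 1/w is
  integrable because s > 1/2.\<close>

lemma fourier_integrable_of_sobolev: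
  assumes s: "1/2 < s" and g: "integrable lborel g"
    and fin: "integrable lborel (\<lambda>\<xi>. (cmod (fourier g \<xi>))\<^sup>2 * (1 + \<xi>\<^sup>2) powr s)"
  shows "integrable lborel (fourier g)"
proof (rule Bochner_Integration.integrable_bound)
  show "integrable lborel (\<lambda>\<xi>. (cmod (fourier g \<xi>))\<^sup>2 * (1 + \<xi>\<^sup>2) powr s + (1 + \<xi>\<^sup>2) powr (-s))"
    by (intro Bochner_Integration.integrable_add fin integrable_bessel_weight s)
  show "fourier g \<in> borel_measurable lborel"
    using borel_measurable_fourier[OF g] by simp
  show "AE \<xi> in lborel. norm (fourier g \<xi>) \<le> norm ((cmod (fourier g \<xi>))\<^sup>2 * (1 + \<xi>\<^sup>2) powr s + (1 + \<xi>\<^sup>2) powr (-s))"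
  proof (rule AE_I2)
    fix \<xi> :: real
    define w where "w = (1 + \<xi>\<^sup>2) powr s"
    define t where "t = cmod (fourier g \<xi>)"
    have "w > 0"
      unfolding w_def using zero_le_power2[of \<xi>] by (smt (verit) powr_gt_zero)
    have "t \<le> t\<^sup>2 * w + inverse w"
    proof (cases "t * w \<le> 1")
      case True
      then have "t \<le> inverse w"
        using \<open>w > 0\<close> by (simp add: field_simps)
      also have "\<dots> \<le> t\<^sup>2 * w + inverse w"
        using \<open>w > 0\<close> by simp
      finally show ?thesis .
    next
      case False
      then have "t * 1 \<le> t * (t * w)"
        by (intro mult_left_mono) (auto simp: t_def)
      also have "\<dots> \<le> t\<^sup>2 * w + inverse w"
        using \<open>w > 0\<close> by (simp add: power2_eq_square)
      finally show ?thesis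
        by simp
    qed
    moreover have "0 \<le> t\<^sup>2 * w + inverse w"
      using \<open>w > 0\<close> by simp
    ultimately show "norm (fourier g \<xi>) \<le> norm ((cmod (fourier g \<xi>))\<^sup>2 * (1 + \<xi>\<^sup>2) powr s + (1 + \<xi>\<^sup>2) powr (-s))"
      by (simp add: w_def t_def powr_minus)
  qed
qed

lemma sobolev_sqnorm_finite_iff:
  assumes "integrable lborel g"
  shows "sobolev_sqnorm s g < \<infinity> \<longleftrightarrow>
    integrable lborel (\<lambda>\<xi>. (cmod (fourier g \<xi>))\<^sup>2 * (1 + \<xi>\<^sup>2) powr s)"
  using borel_measurable_fourier[OF assms]
  by (simp add: sobolev_sqnorm_def integrable_iff_bounded)

lemma sobolev_sqnorm_eq_integral:
  assumes "integrable lborel (\<lambda>\<xi>. (cmod (fourier g \<xi>))\<^sup>2 * (1 + \<xi>\<^sup>2) powr s)"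
  shows "sobolev_sqnorm s g = ennreal (LINT \<xi>|lborel. (cmod (fourier g \<xi>))\<^sup>2 * (1 + \<xi>\<^sup>2) powr s)"
  using assms by (simp add: sobolev_sqnorm_def nn_integral_eq_integral)

text \<open>With w = 1 + \<xi>^2, the exponent s \<le> 1 lets w^s be replaced by w, and the decay
  then bounds the integrand by C^2/w, the integrable weight of exponent 1.\<close>

lemma sobolev_integrable_of_decay:
  assumes g: "integrable lborel g" and "s \<le> 1"
    and decay: "\<And>\<xi>. (1 + \<xi>\<^sup>2) * cmod (fourier g \<xi>) \<le> C"
  shows "integrable lborel (\<lambda>\<xi>. (cmod (fourier g \<xi>))\<^sup>2 * (1 + \<xi>\<^sup>2) powr s)"
proof (rule Bochner_Integration.integrable_bound)
  show "integrable lborel (\<lambda>\<xi>. C\<^sup>2 * (1 + \<xi>\<^sup>2) powr (- 1) :: real)"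
    by (intro integrable_mult_right integrable_bessel_weight) auto
  show "(\<lambda>\<xi>. (cmod (fourier g \<xi>))\<^sup>2 * (1 + \<xi>\<^sup>2) powr s) \<in> borel_measurable lborel"
    using borel_measurable_fourier[OF g] by simp
  show "AE \<xi> in lborel. norm ((cmod (fourier g \<xi>))\<^sup>2 * (1 + \<xi>\<^sup>2) powr s) \<le> norm (C\<^sup>2 * (1 + \<xi>\<^sup>2) powr (- 1))"
  proof (rule AE_I2)
    fix \<xi> :: real
    define w where "w = 1 + \<xi>\<^sup>2"
    have "w \<ge> 1"
      by (simp add: w_def)
    have "(cmod (fourier g \<xi>))\<^sup>2 * w powr s \<le> (cmod (fourier g \<xi>))\<^sup>2 * w powr 1"
      using \<open>w \<ge> 1\<close> \<open>s \<le> 1\<close> by (intro mult_left_mono powr_mono) auto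
    also have "\<dots> = (w * cmod (fourier g \<xi>))\<^sup>2 / w"
      using \<open>w \<ge> 1\<close> by (simp add: power2_eq_square)
    also have "\<dots> \<le> C\<^sup>2 / w"
      using decay[of \<xi>] \<open>w \<ge> 1\<close> by (intro divide_right_mono power_mono) (auto simp: w_def)
    finally show "norm ((cmod (fourier g \<xi>))\<^sup>2 * (1 + \<xi>\<^sup>2) powr s) \<le> norm (C\<^sup>2 * (1 + \<xi>\<^sup>2) powr (- 1))"
      using \<open>w \<ge> 1\<close> by (simp add: w_def powr_minus_divide abs_mult)
  qed
qed

text \<open>The conjugated transform of \<open>\<phi>'\<close> is i \<xi> times that of
  \<open>\<phi>\<close>, the boundary values being zero. Multiplied with the sign of \<xi> this
  yields \<open>\<bar>\<xi>\<bar>\<close>, and (-i/2) i = 1/2. Differentiating the test function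
  thus turns the sign multiplier into a nonnegative one.\<close>

lemma hilbert_deriv_pairing:
  fixes G :: "real \<Rightarrow> complex"
  assumes "a \<le> b" and G: "integrable lborel G"
    and \<phi>: "\<And>x. x \<in> {a..b} \<Longrightarrow> (\<phi> has_vector_derivative \<phi>' x) (at x within {a..b})"
    and cont: "continuous_on {a..b} \<phi>'"
    and zero: "\<phi> a = 0" "\<phi> b = 0"
  shows "(LINT y|lborel. cnj (zero_ext {a..b} \<phi>' y) *
      (- (\<i> / 2) * (LINT \<xi>|lborel. G \<xi> * exp (- (\<i> * complex_of_real (y * \<xi>))) * complex_of_real (sgn \<xi>)))) =
    1 / 2 * (LINT \<xi>|lborel. complex_of_real \<bar>\<xi>\<bar> * (G \<xi> * cnj (fourier (zero_ext {a..b} \<phi>) \<xi>)))"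
proof -
  let ?z = "zero_ext {a..b} \<phi>'"
  have z: "integrable lborel (\<lambda>y. cnj (?z y))"
    using integrable_zero_ext[OF cont] by simp
  have Gs: "integrable lborel (\<lambda>\<xi>. G \<xi> * complex_of_real (sgn \<xi>))"
    by (rule integrable_bounded_factor[OF G, where B=1]) (auto simp: sgn_if)
  have "(LINT y|lborel. cnj (?z y) *
      (- (\<i> / 2) * (LINT \<xi>|lborel. G \<xi> * exp (- (\<i> * complex_of_real (y * \<xi>))) * complex_of_real (sgn \<xi>)))) =
    (LINT y|lborel. - (\<i> / 2) * (cnj (?z y) *
      (LINT \<xi>|lborel. G \<xi> * complex_of_real (sgn \<xi>) * exp (- (\<i> * complex_of_real (y * \<xi>))))))"
    by (simp only: mult_ac)
  also have "\<dots> = - (\<i> / 2) * (LINT y|lborel. cnj (?z y) *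
      (LINT \<xi>|lborel. G \<xi> * complex_of_real (sgn \<xi>) * exp (- (\<i> * complex_of_real (y * \<xi>)))))"
    by (rule integral_mult_right_zero)
  also have "(LINT y|lborel. cnj (?z y) *
      (LINT \<xi>|lborel. G \<xi> * complex_of_real (sgn \<xi>) * exp (- (\<i> * complex_of_real (y * \<xi>))))) =
    (LINT \<xi>|lborel. G \<xi> * complex_of_real (sgn \<xi>) *
      (LINT y|lborel. cnj (?z y) * exp (- (\<i> * complex_of_real (y * \<xi>)))))"
    by (rule Fubini_bounded_kernel[OF z Gs, where B=1]) auto
  also have "\<dots> = (LINT \<xi>|lborel. \<i> * (complex_of_real \<bar>\<xi>\<bar> * (G \<xi> * cnj (fourier (zero_ext {a..b} \<phi>) \<xi>))))"
  proof (intro Bochner_Integration.integral_cong refl)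
    fix \<xi>
    have "(LINT y|lborel. cnj (?z y) * exp (- (\<i> * complex_of_real (y * \<xi>)))) =
        (LINT y|lborel. cnj (?z y * exp (\<i> * complex_of_real (y * \<xi>))))"
      by (intro Bochner_Integration.integral_cong) (simp_all add: exp_cnj)
    also have "\<dots> = cnj (fourier ?z \<xi>)"
      unfolding fourier_def by (rule Bochner_Integration.integral_cnj)
    also have "\<dots> = \<i> * complex_of_real \<xi> * cnj (fourier (zero_ext {a..b} \<phi>) \<xi>)"
      using fourier_zero_ext_deriv[OF \<open>a \<le> b\<close> \<phi> cont, of \<xi>] by (simp add: zero)
    also have "G \<xi> * complex_of_real (sgn \<xi>) * \<dots> =
        \<i> * (complex_of_real (sgn \<xi> * \<xi>) * (G \<xi> * cnj (fourier (zero_ext {a..b} \<phi>) \<xi>)))"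
      by (simp add: mult_ac)
    finally show "G \<xi> * complex_of_real (sgn \<xi>) * (LINT y|lborel. cnj (?z y) * exp (- (\<i> * complex_of_real (y * \<xi>)))) =
        \<i> * (complex_of_real \<bar>\<xi>\<bar> * (G \<xi> * cnj (fourier (zero_ext {a..b} \<phi>) \<xi>)))"
      by (simp add: mult.commute[of "sgn \<xi>"] linordered_idom_class.mult_sgn_abs abs_sgn[symmetric])
  qed
  also have "\<dots> = \<i> * (LINT \<xi>|lborel. complex_of_real \<bar>\<xi>\<bar> * (G \<xi> * cnj (fourier (zero_ext {a..b} \<phi>) \<xi>)))"
    by (rule integral_mult_right_zero)
  finally show ?thesis
    by simp
qed

section \<open>The energy form\<close>

text \<open>The row index goes with the conjugated argument, so that row j is the j-th equation of
  the system paired with the j-th component of the test function.\<close>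

definition sesquilinear_form :: "real ^ 'n ^ 'n \<Rightarrow> ('n \<Rightarrow> complex) \<Rightarrow> ('n \<Rightarrow> complex) \<Rightarrow> complex" where
  "sesquilinear_form A v w =
     (\<Sum>j\<in>UNIV. \<Sum>k\<in>UNIV. complex_of_real (A $ j $ k) * (v k * cnj (w j)))"

text \<open>The real part of \<open>v k * cnj (v j)\<close> is the product of the real parts plus
  the product of the imaginary parts. Positive definiteness, stated for real vectors, thereby
  applies to complex ones.\<close>

lemma Re_sesquilinear_form_self:
  "Re (sesquilinear_form A v v) =
     (\<chi> j. Re (v j)) \<bullet> (A *v (\<chi> j. Re (v j))) + (\<chi> j. Im (v j)) \<bullet> (A *v (\<chi> j. Im (v j)))"
  by (simp add: sesquilinear_form_def inner_vec_def matrix_vector_mult_def sum_distrib_left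
      distrib_left sum.distrib mult_ac)

lemma sesquilinear_form_nonneg:
  assumes "positive_definite A"
  shows "0 \<le> Re (sesquilinear_form A v v)"
proof -
  have "0 \<le> x \<bullet> (A *v x)" for x
    using assms by (cases "x = 0") (auto simp: positive_definite_def less_imp_le)
  then show ?thesis
    by (simp add: Re_sesquilinear_form_self)
qed

lemma sesquilinear_form_eq_0D:
  assumes "positive_definite A" and "Re (sesquilinear_form A v v) = 0"
  shows "v j = 0"
proof -
  have pos: "0 \<le> x \<bullet> (A *v x)" "x \<bullet> (A *v x) = 0 \<Longrightarrow> x = 0" for x
    using assms(1) by (cases "x = 0"; force simp: positive_definite_def)+
  have "(\<chi> j. Re (v j)) = 0" "(\<chi> j. Im (v j)) = 0"
    using assms(2) pos(1)[of "\<chi> j. Re (v j)"] pos(1)[of "\<chi> j. Im (v j)"]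
    by (auto intro!: pos(2) simp: Re_sesquilinear_form_self)
  then show ?thesis
    by (simp add: vec_eq_iff complex_eq_iff)
qed

text \<open>Symmetry of the real matrix makes the form Hermitian, so the two mixed terms are
  conjugate and have the same real part.\<close>

lemma Re_sesquilinear_form_diff:
  assumes "transpose A = A"
  shows "Re (sesquilinear_form A (\<lambda>k. v k - w k) (\<lambda>k. v k - w k)) =
    Re (sesquilinear_form A v v) + Re (sesquilinear_form A w w) - 2 * Re (sesquilinear_form A v w)"
proof -
  have sym: "A $ k $ j = A $ j $ k" for j k
    using assms by (simp add: vec_eq_iff transpose_def)
  have "sesquilinear_form A w v = cnj (sesquilinear_form A v w)"
    unfolding sesquilinear_form_def
    by (subst sum.swap) (simp add: sym mult.commute)
  moreover have "sesquilinear_form A (\<lambda>k. v k - w k) (\<lambda>k. v k - w k) =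
      sesquilinear_form A v v + sesquilinear_form A w w - sesquilinear_form A v w - sesquilinear_form A w v"
    unfolding sesquilinear_form_def sum.distrib[symmetric] sum_subtractf[symmetric]
    by (simp add: algebra_simps)
  ultimately show ?thesis
    by simp
qed

text \<open>Each product of two moduli is at most the square of the larger one, which is a summand
  of the sum of squares.\<close>

lemma norm_sesquilinear_form_le:
  "cmod (sesquilinear_form A v v) \<le> (\<Sum>j\<in>UNIV. \<Sum>k\<in>UNIV. \<bar>A $ j $ k\<bar>) * (\<Sum>j\<in>UNIV. (cmod (v j))\<^sup>2)"
proof -
  have "cmod (v k) * cmod (v j) \<le> (\<Sum>j\<in>UNIV. (cmod (v j))\<^sup>2)" for j k
  proof -
    have "cmod (v k) * cmod (v j) \<le> (max (cmod (v k)) (cmod (v j)))\<^sup>2"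
      unfolding power2_eq_square by (intro mult_mono) (auto simp: le_max_iff_disj)
    also have "\<dots> \<le> (\<Sum>j\<in>UNIV. (cmod (v j))\<^sup>2)"
      by (cases "cmod (v k) \<le> cmod (v j)") (auto intro!: member_le_sum)
    finally show ?thesis .
  qed
  then have "cmod (complex_of_real (A $ j $ k) * (v k * cnj (v j))) \<le> \<bar>A $ j $ k\<bar> * (\<Sum>j\<in>UNIV. (cmod (v j))\<^sup>2)" for j k
    by (simp add: norm_mult mult_left_mono)
  then show ?thesis
    unfolding sesquilinear_form_def sum_distrib_right by (intro sum_norm_le)
qed

lemma abs_le_bessel_weight:
  fixes \<xi> :: real
  assumes "1/2 \<le> s"
  shows "\<bar>\<xi>\<bar> \<le> (1 + \<xi>\<^sup>2) powr s"
proof -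
  have "\<bar>\<xi>\<bar> \<le> sqrt (1 + \<xi>\<^sup>2)"
    by (intro real_le_rsqrt) auto
  also have "\<dots> = (1 + \<xi>\<^sup>2) powr (1/2)"
    by (simp add: powr_half_sqrt)
  also have "\<dots> \<le> (1 + \<xi>\<^sup>2) powr s"
    using assms by (intro powr_mono) auto
  finally show ?thesis .
qed

lemma borel_measurable_cnj [measurable]: "cnj \<in> borel_measurable borel"
  by (intro borel_measurable_continuous_onI continuous_intros)

text \<open>The energy is controlled by the Sobolev norm: both claims follow from one pointwise
  bound, which combines \<open>\<bar>\<xi>\<bar> \<le> (1 + \<xi>\<^sup>2) powr s\<close> with the
  entrywise bound of the form.\<close>

lemma integrable_energy:
  fixes v :: "'n::finite \<Rightarrow> real \<Rightarrow> complex"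
  assumes "1/2 \<le> s" and [measurable]: "\<And>k. v k \<in> borel_measurable borel"
    and int: "\<And>k. integrable lborel (\<lambda>\<xi>. (cmod (v k \<xi>))\<^sup>2 * (1 + \<xi>\<^sup>2) powr s)"
  shows "integrable lborel (\<lambda>\<xi>. \<bar>\<xi>\<bar> * Re (sesquilinear_form A (\<lambda>k. v k \<xi>) (\<lambda>k. v k \<xi>)))"
    and "(LINT \<xi>|lborel. \<bar>\<xi>\<bar> * Re (sesquilinear_form A (\<lambda>k. v k \<xi>) (\<lambda>k. v k \<xi>))) \<le>
      (\<Sum>j\<in>UNIV. \<Sum>k\<in>UNIV. \<bar>A $ j $ k\<bar>) *
      (\<Sum>k\<in>UNIV. LINT \<xi>|lborel. (cmod (v k \<xi>))\<^sup>2 * (1 + \<xi>\<^sup>2) powr s)"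
proof -
  define C where "C = (\<Sum>j\<in>UNIV. \<Sum>k\<in>UNIV. \<bar>A $ j $ k\<bar>)"
  have "C \<ge> 0"
    unfolding C_def by (intro sum_nonneg) auto
  have bound: "\<bar>\<bar>\<xi>\<bar> * Re (sesquilinear_form A (\<lambda>k. v k \<xi>) (\<lambda>k. v k \<xi>))\<bar> \<le>
      C * (\<Sum>k\<in>UNIV. (cmod (v k \<xi>))\<^sup>2 * (1 + \<xi>\<^sup>2) powr s)" for \<xi>
  proof -
    have "\<bar>\<bar>\<xi>\<bar> * Re (sesquilinear_form A (\<lambda>k. v k \<xi>) (\<lambda>k. v k \<xi>))\<bar> \<le>
        (1 + \<xi>\<^sup>2) powr s * (C * (\<Sum>k\<in>UNIV. (cmod (v k \<xi>))\<^sup>2))"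
      unfolding abs_mult abs_idempotent C_def
      by (intro mult_mono abs_le_bessel_weight assms order_trans[OF abs_Re_le_cmod norm_sesquilinear_form_le]) auto
    then show ?thesis
      by (simp add: sum_distrib_left mult_ac)
  qed
  have int_bound: "integrable lborel (\<lambda>\<xi>. C * (\<Sum>k\<in>UNIV. (cmod (v k \<xi>))\<^sup>2 * (1 + \<xi>\<^sup>2) powr s))"
    by (intro integrable_mult_right Bochner_Integration.integrable_sum int)
  have [measurable]: "(\<lambda>\<xi>. \<bar>\<xi>\<bar> * Re (sesquilinear_form A (\<lambda>k. v k \<xi>) (\<lambda>k. v k \<xi>))) \<in> borel_measurable borel"
    unfolding sesquilinear_form_def by measurable
  show *: "integrable lborel (\<lambda>\<xi>. \<bar>\<xi>\<bar> * Re (sesquilinear_form A (\<lambda>k. v k \<xi>) (\<lambda>k. v k \<xi>)))"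
    by (rule Bochner_Integration.integrable_bound[OF int_bound])
       (use bound in \<open>auto intro!: AE_I2 order_trans[OF _ abs_ge_self]\<close>)
  have "(LINT \<xi>|lborel. \<bar>\<xi>\<bar> * Re (sesquilinear_form A (\<lambda>k. v k \<xi>) (\<lambda>k. v k \<xi>))) \<le>
      (LINT \<xi>|lborel. C * (\<Sum>k\<in>UNIV. (cmod (v k \<xi>))\<^sup>2 * (1 + \<xi>\<^sup>2) powr s))"
    using bound by (intro integral_mono * int_bound) (auto intro: order_trans[OF abs_ge_self])
  also have "\<dots> = C * (\<Sum>k\<in>UNIV. LINT \<xi>|lborel. (cmod (v k \<xi>))\<^sup>2 * (1 + \<xi>\<^sup>2) powr s)"
    by (simp add: Bochner_Integration.integral_sum int)
  finally show "(LINT \<xi>|lborel. \<bar>\<xi>\<bar> * Re (sesquilinear_form A (\<lambda>k. v k \<xi>) (\<lambda>k. v k \<xi>))) \<le>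
      (\<Sum>j\<in>UNIV. \<Sum>k\<in>UNIV. \<bar>A $ j $ k\<bar>) *
      (\<Sum>k\<in>UNIV. LINT \<xi>|lborel. (cmod (v k \<xi>))\<^sup>2 * (1 + \<xi>\<^sup>2) powr s)"
    by (simp add: C_def)
qed

text \<open>Expanding the form at \<open>F - P\<close> and dropping the nonnegative term of
  \<open>P\<close> bounds the energy density of \<open>F\<close> by that of \<open>F - P\<close>
  plus twice a cross term. The cross term integrates to 0 by orthogonality.\<close>

lemma energy_le_of_orthogonal:
  fixes F P :: "'n::finite \<Rightarrow> real \<Rightarrow> complex"
  assumes A: "transpose A = A" "positive_definite A" and s: "1/2 \<le> s"
    and [measurable]: "\<And>k. F k \<in> borel_measurable borel" "\<And>k. P k \<in> borel_measurable borel"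
    and F: "\<And>k. integrable lborel (\<lambda>\<xi>. (cmod (F k \<xi>))\<^sup>2 * (1 + \<xi>\<^sup>2) powr s)"
    and FP: "\<And>k. integrable lborel (\<lambda>\<xi>. (cmod (F k \<xi> - P k \<xi>))\<^sup>2 * (1 + \<xi>\<^sup>2) powr s)"
    and cross: "\<And>j k. integrable lborel (\<lambda>\<xi>. complex_of_real \<bar>\<xi>\<bar> * (F k \<xi> * cnj (P j \<xi>)))"
    and orth: "\<And>j. (\<Sum>k\<in>UNIV. complex_of_real (A $ j $ k) *
      (LINT \<xi>|lborel. complex_of_real \<bar>\<xi>\<bar> * (F k \<xi> * cnj (P j \<xi>)))) = 0"
  shows "(LINT \<xi>|lborel. \<bar>\<xi>\<bar> * Re (sesquilinear_form A (\<lambda>k. F k \<xi>) (\<lambda>k. F k \<xi>))) \<le>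
    (\<Sum>j\<in>UNIV. \<Sum>k\<in>UNIV. \<bar>A $ j $ k\<bar>) *
    (\<Sum>k\<in>UNIV. LINT \<xi>|lborel. (cmod (F k \<xi> - P k \<xi>))\<^sup>2 * (1 + \<xi>\<^sup>2) powr s)"
proof -
  let ?q = "\<lambda>v. Re (sesquilinear_form A v v)"
  \<comment> \<open>The cross term is kept as a double sum, so that its integral splits into the
    rows that \<open>orth\<close> annihilates.\<close>
  let ?X = "\<lambda>\<xi>. \<Sum>j\<in>UNIV. \<Sum>k\<in>UNIV. complex_of_real (A $ j $ k) * (complex_of_real \<bar>\<xi>\<bar> * (F k \<xi> * cnj (P j \<xi>)))"
  have X_eq: "?X \<xi> = complex_of_real \<bar>\<xi>\<bar> * sesquilinear_form A (\<lambda>k. F k \<xi>) (\<lambda>k. P k \<xi>)" for \<xi>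
    by (simp add: sesquilinear_form_def sum_distrib_left mult_ac)
  have X_int: "integrable lborel ?X"
    by (intro Bochner_Integration.integrable_sum integrable_mult_right cross)
  have "integral\<^sup>L lborel ?X = 0"
    by (subst Bochner_Integration.integral_sum, intro Bochner_Integration.integrable_sum integrable_mult_right cross,
        rule sum.neutral, intro ballI, subst Bochner_Integration.integral_sum, intro integrable_mult_right cross)
       (simp only: integral_mult_right_zero orth)
  then have X_0: "(LINT \<xi>|lborel. Re (?X \<xi>)) = 0"
    using integral_Re[OF X_int] by simp
  note int = integrable_energy(1)[OF s _ F, where A=A] integrable_energy[where v="\<lambda>k \<xi>. F k \<xi> - P k \<xi>" and A=A, OF s _ FP]
  have "\<bar>\<xi>\<bar> * ?q (\<lambda>k. F k \<xi>) \<le> \<bar>\<xi>\<bar> * ?q (\<lambda>k. F k \<xi> - P k \<xi>) + 2 * Re (?X \<xi>)" for \<xi>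
  proof -
    have Re_X: "Re (?X \<xi>) = \<bar>\<xi>\<bar> * Re (sesquilinear_form A (\<lambda>k. F k \<xi>) (\<lambda>k. P k \<xi>))"
      unfolding X_eq by simp
    have "0 \<le> \<bar>\<xi>\<bar> * ?q (\<lambda>k. P k \<xi>)"
      by (intro mult_nonneg_nonneg sesquilinear_form_nonneg A) auto
    then show ?thesis
      unfolding Re_X Re_sesquilinear_form_diff[OF A(1)] by (simp add: algebra_simps)
  qed
  then have "(LINT \<xi>|lborel. \<bar>\<xi>\<bar> * ?q (\<lambda>k. F k \<xi>)) \<le>
      (LINT \<xi>|lborel. \<bar>\<xi>\<bar> * ?q (\<lambda>k. F k \<xi> - P k \<xi>) + 2 * Re (?X \<xi>))"
    using X_int by (intro integral_mono Bochner_Integration.integrable_add int integrable_mult_right integrable_Re) measurable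
  also have "\<dots> = (LINT \<xi>|lborel. \<bar>\<xi>\<bar> * ?q (\<lambda>k. F k \<xi> - P k \<xi>)) + (LINT \<xi>|lborel. 2 * Re (?X \<xi>))"
    using X_int by (intro Bochner_Integration.integral_add int integrable_mult_right integrable_Re) measurable
  also have "(LINT \<xi>|lborel. 2 * Re (?X \<xi>)) = 0"
    by (simp only: integral_mult_right_zero X_0)
  also have "(LINT \<xi>|lborel. \<bar>\<xi>\<bar> * ?q (\<lambda>k. F k \<xi> - P k \<xi>)) + 0 \<le>
      (\<Sum>j\<in>UNIV. \<Sum>k\<in>UNIV. \<bar>A $ j $ k\<bar>) *
      (\<Sum>k\<in>UNIV. LINT \<xi>|lborel. (cmod (F k \<xi> - P k \<xi>))\<^sup>2 * (1 + \<xi>\<^sup>2) powr s)"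
    unfolding add_0_right by (rule int) measurable
  finally show ?thesis .
qed

section \<open>Uniqueness\<close>

text \<open>Writing the transform of \<open>g\<close> as a difference plus that of \<open>h\<close>,
  the bound (p + q)^2 \<le> 2 p^2 + 2 q^2 applies. A single approximant at finite distance thus
  gives finiteness of the norm of \<open>g\<close>.\<close>

lemma sobolev_integrable_add:
  assumes "integrable lborel g" "integrable lborel h"
    and "integrable lborel (\<lambda>\<xi>. (cmod (fourier g \<xi> - fourier h \<xi>))\<^sup>2 * (1 + \<xi>\<^sup>2) powr s)"
    and "integrable lborel (\<lambda>\<xi>. (cmod (fourier h \<xi>))\<^sup>2 * (1 + \<xi>\<^sup>2) powr s)"
  shows "integrable lborel (\<lambda>\<xi>. (cmod (fourier g \<xi>))\<^sup>2 * (1 + \<xi>\<^sup>2) powr s)"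
proof (rule Bochner_Integration.integrable_bound)
  let ?w = "\<lambda>\<xi>::real. (1 + \<xi>\<^sup>2) powr s"
  show "integrable lborel (\<lambda>\<xi>. 2 * ((cmod (fourier g \<xi> - fourier h \<xi>))\<^sup>2 * ?w \<xi>) + 2 * ((cmod (fourier h \<xi>))\<^sup>2 * ?w \<xi>))"
    by (intro Bochner_Integration.integrable_add integrable_mult_right assms)
  show "(\<lambda>\<xi>. (cmod (fourier g \<xi>))\<^sup>2 * ?w \<xi>) \<in> borel_measurable lborel"
    using borel_measurable_fourier[OF assms(1)] by simp
  show "AE \<xi> in lborel. norm ((cmod (fourier g \<xi>))\<^sup>2 * ?w \<xi>) \<le>
      norm (2 * ((cmod (fourier g \<xi> - fourier h \<xi>))\<^sup>2 * ?w \<xi>) + 2 * ((cmod (fourier h \<xi>))\<^sup>2 * ?w \<xi>))"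
  proof (rule AE_I2)
    fix \<xi>
    let ?d = "cmod (fourier g \<xi> - fourier h \<xi>)" and ?h = "cmod (fourier h \<xi>)"
    have "cmod (fourier g \<xi>) \<le> ?d + ?h"
      using norm_triangle_ineq[of "fourier g \<xi> - fourier h \<xi>" "fourier h \<xi>"] by simp
    then have "(cmod (fourier g \<xi>))\<^sup>2 \<le> (?d + ?h)\<^sup>2"
      by (intro power_mono) auto
    also have "\<dots> \<le> 2 * ?d\<^sup>2 + 2 * ?h\<^sup>2"
      using sum_squares_bound[of ?d ?h] by (simp add: power2_sum)
    finally have "(cmod (fourier g \<xi>))\<^sup>2 * ?w \<xi> \<le> (2 * ?d\<^sup>2 + 2 * ?h\<^sup>2) * ?w \<xi>"
      by (intro mult_right_mono) auto
    then show "norm ((cmod (fourier g \<xi>))\<^sup>2 * ?w \<xi>) \<le>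
      norm (2 * (?d\<^sup>2 * ?w \<xi>) + 2 * (?h\<^sup>2 * ?w \<xi>))"
      by (simp add: algebra_simps)
  qed
qed

lemma zero_ext_diff: "zero_ext A (\<lambda>x. f x - g x) = (\<lambda>x. zero_ext A f x - zero_ext A g x)"
  by (auto simp: zero_ext_def)

lemma C0_inf_integrable:
  assumes "\<phi> \<in> C0_inf \<alpha> \<beta>"
  shows "integrable lborel (zero_ext {\<alpha> j..\<beta> j} \<phi>)"
  using assms by (elim C0_infE) (rule integrable_zero_ext, rule continuous_on_vector_derivative, blast)

lemma C0_inf_fourier_decay:
  assumes "\<phi> \<in> C0_inf \<alpha> \<beta>" and "\<alpha> j \<le> \<beta> j"
  obtains C where "\<And>\<xi>. (1 + \<xi>\<^sup>2) * cmod (fourier (zero_ext {\<alpha> j..\<beta> j} \<phi>) \<xi>) \<le> C"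
proof -
  obtain \<phi>' \<phi>'' where *:
    "\<And>x. x \<in> {\<alpha> j..\<beta> j} \<Longrightarrow> (\<phi> has_vector_derivative \<phi>' x) (at x within {\<alpha> j..\<beta> j})"
    "\<And>x. x \<in> {\<alpha> j..\<beta> j} \<Longrightarrow> (\<phi>' has_vector_derivative \<phi>'' x) (at x within {\<alpha> j..\<beta> j})"
    "continuous_on {\<alpha> j..\<beta> j} \<phi>''" "\<phi> (\<alpha> j) = 0" "\<phi> (\<beta> j) = 0"
    using C0_infE[OF assms(1)] by metis
  show thesis
    using fourier_zero_ext_decay[OF assms(2) *] that by blast
qed

text \<open>Passes from convergence of extended norms to convergence of real integrals, and recovers
  from it that the norm of \<open>f\<close> itself is finite.\<close>

lemma HdotE:
  fixes \<alpha> \<beta> :: "'n::finite \<Rightarrow> real"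
  assumes f: "f \<in> Hdot s \<alpha> \<beta>" and "s \<le> 1" and le: "\<And>j. \<alpha> j \<le> \<beta> j"
  obtains \<phi> :: "nat \<Rightarrow> real \<Rightarrow> complex" where
    "\<And>m. \<phi> m \<in> C0_inf \<alpha> \<beta>"
    "\<And>m k. integrable lborel (\<lambda>\<xi>. (cmod (fourier (zero_ext {\<alpha> k..\<beta> k} f) \<xi>
      - fourier (zero_ext {\<alpha> k..\<beta> k} (\<phi> m)) \<xi>))\<^sup>2 * (1 + \<xi>\<^sup>2) powr s)"
    "\<And>k. integrable lborel (\<lambda>\<xi>. (cmod (fourier (zero_ext {\<alpha> k..\<beta> k} f) \<xi>))\<^sup>2 * (1 + \<xi>\<^sup>2) powr s)"
    "(\<lambda>m. \<Sum>k\<in>UNIV. LINT \<xi>|lborel. (cmod (fourier (zero_ext {\<alpha> k..\<beta> k} f) \<xi>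
      - fourier (zero_ext {\<alpha> k..\<beta> k} (\<phi> m)) \<xi>))\<^sup>2 * (1 + \<xi>\<^sup>2) powr s) \<longlonglongrightarrow> 0"
proof -
  let ?z = "\<lambda>k. zero_ext {\<alpha> k..\<beta> k}"
  from f obtain \<phi> :: "nat \<Rightarrow> real \<Rightarrow> complex" where cont: "continuous_on (interval_union \<alpha> \<beta>) f"
    and \<phi>: "\<And>m. \<phi> m \<in> C0_inf \<alpha> \<beta>"
    and lim: "(\<lambda>m. Hdot_sqnorm s \<alpha> \<beta> (\<lambda>x. f x - \<phi> m x)) \<longlonglongrightarrow> 0"
    by (auto simp: Hdot_def)
  have f_int: "integrable lborel (?z k f)" for k
    using cont by (intro integrable_zero_ext continuous_on_subset[OF cont]) (auto simp: interval_union_def)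
  have \<phi>_int: "integrable lborel (?z k (\<phi> m))" for k m
    by (rule C0_inf_integrable[OF \<phi>])
  have diff_int: "integrable lborel (?z k (\<lambda>x. f x - \<phi> m x))" for k m
    unfolding zero_ext_diff by (intro Bochner_Integration.integrable_diff f_int \<phi>_int)
  have fourier_eq: "fourier (?z k (\<lambda>x. f x - \<phi> m x)) \<xi> = fourier (?z k f) \<xi> - fourier (?z k (\<phi> m)) \<xi>" for k m \<xi>
    unfolding zero_ext_diff by (intro fourier_diff f_int \<phi>_int)
  \<comment> \<open>Convergence to 0 in \<open>ennreal\<close> allows infinite values at the start.
    The sequence is therefore shifted by \<open>N\<close>, after which every distance is
    finite.\<close>
  have "eventually (\<lambda>m. Hdot_sqnorm s \<alpha> \<beta> (\<lambda>x. f x - \<phi> m x) < \<infinity>) sequentially"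
    using order_tendstoD(2)[OF lim, of \<infinity>] by simp
  then obtain N where N: "\<And>m. m \<ge> N \<Longrightarrow> Hdot_sqnorm s \<alpha> \<beta> (\<lambda>x. f x - \<phi> m x) < \<infinity>"
    by (auto simp: eventually_sequentially)
  have fin: "integrable lborel (\<lambda>\<xi>. (cmod (fourier (?z k (\<lambda>x. f x - \<phi> (m + N) x)) \<xi>))\<^sup>2 * (1 + \<xi>\<^sup>2) powr s)" for m k
  proof (subst sobolev_sqnorm_finite_iff[OF diff_int, symmetric])
    have "sobolev_sqnorm s (?z k (\<lambda>x. f x - \<phi> (m + N) x)) \<le> Hdot_sqnorm s \<alpha> \<beta> (\<lambda>x. f x - \<phi> (m + N) x)"
      unfolding Hdot_sqnorm_def by (rule member_le_sum) auto
    also have "\<dots> < \<infinity>"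
      by (rule N) simp
    finally show "sobolev_sqnorm s (?z k (\<lambda>x. f x - \<phi> (m + N) x)) < \<infinity>" .
  qed
  have \<phi>_fin: "integrable lborel (\<lambda>\<xi>. (cmod (fourier (?z k (\<phi> m)) \<xi>))\<^sup>2 * (1 + \<xi>\<^sup>2) powr s)" for m k
  proof -
    obtain C where "\<And>\<xi>. (1 + \<xi>\<^sup>2) * cmod (fourier (?z k (\<phi> m)) \<xi>) \<le> C"
      using C0_inf_fourier_decay[OF \<phi> le] by blast
    then show ?thesis
      by (intro sobolev_integrable_of_decay[OF \<phi>_int \<open>s \<le> 1\<close>])
  qed
  show thesis
  proof
    show "\<phi> (m + N) \<in> C0_inf \<alpha> \<beta>" for m
      by (rule \<phi>)
    show 1: "integrable lborel (\<lambda>\<xi>. (cmod (fourier (?z k f) \<xi> - fourier (?z k (\<phi> (m + N))) \<xi>))\<^sup>2 * (1 + \<xi>\<^sup>2) powr s)" for m k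
      using fin[of k m] by (simp add: fourier_eq)
    show "integrable lborel (\<lambda>\<xi>. (cmod (fourier (?z k f) \<xi>))\<^sup>2 * (1 + \<xi>\<^sup>2) powr s)" for k
      by (rule sobolev_integrable_add[OF f_int \<phi>_int 1[of k 0] \<phi>_fin])
    let ?S = "\<lambda>m. \<Sum>k\<in>UNIV. LINT \<xi>|lborel. (cmod (fourier (?z k f) \<xi> - fourier (?z k (\<phi> (m + N))) \<xi>))\<^sup>2 * (1 + \<xi>\<^sup>2) powr s"
    have "Hdot_sqnorm s \<alpha> \<beta> (\<lambda>x. f x - \<phi> (m + N) x) = ennreal (?S m)" for m
      unfolding Hdot_sqnorm_def sobolev_sqnorm_eq_integral[OF fin] fourier_eq
      by (rule sum_ennreal) auto
    moreover have "(\<lambda>m. Hdot_sqnorm s \<alpha> \<beta> (\<lambda>x. f x - \<phi> (m + N) x)) \<longlonglongrightarrow> 0"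
      using lim by (rule LIMSEQ_ignore_initial_segment)
    ultimately have "(\<lambda>m. ennreal (?S m)) \<longlonglongrightarrow> ennreal 0"
      by simp
    moreover have "0 \<le> ?S m" for m
      by (intro sum_nonneg integral_nonneg) auto
    ultimately show "?S \<longlonglongrightarrow> 0"
      by (subst (asm) tendsto_ennreal_iff) auto
  qed
qed

text \<open>Away from the endpoints the extension agrees on an open set with \<open>f\<close> or
  with 0. At an endpoint it may jump.\<close>

lemma isCont_zero_ext:
  assumes cont: "continuous_on {a..b} f" and x: "x \<noteq> a" "x \<noteq> b"
  shows "isCont (zero_ext {a..b} f) x"
proof (cases "x \<in> {a<..<b}")
  case True
  have "continuous_on {a<..<b} (zero_ext {a..b} f)"
    by (rule continuous_on_eq[OF continuous_on_subset[OF cont]]) (auto simp: zero_ext_def)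
  then show ?thesis
    using True by (simp add: continuous_on_eq_continuous_at)
next
  case False
  have "continuous_on (- {a..b}) (zero_ext {a..b} f)"
    by (rule continuous_on_eq[OF continuous_on_const[of _ 0]]) (auto simp: zero_ext_def)
  moreover have "open (- {a..b})" "x \<in> - {a..b}"
    using False x by auto
  ultimately show ?thesis
    by (simp add: continuous_on_eq_continuous_at)
qed

lemma zero_ext_fourier_inversion:
  assumes cont: "continuous_on {a..b} f" and F: "integrable lborel (fourier (zero_ext {a..b} f))"
    and x: "x \<noteq> a" "x \<noteq> b"
  shows "zero_ext {a..b} f x =
    1 / (2 * pi) * (LINT \<xi>|lborel. fourier (zero_ext {a..b} f) \<xi> * exp (- (\<i> * complex_of_real (x * \<xi>))))"
proof -
  obtain B where "\<And>x. cmod (zero_ext {a..b} f x) \<le> B"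
    using zero_ext_bounded[OF cont] by blast
  from fourier_inversion[OF integrable_zero_ext[OF cont] this F isCont_zero_ext[OF cont x]]
  show ?thesis .
qed

text \<open>Inversion may fail only at the two endpoints, a null set. Convergence is part of what is
  shown, so \<open>Lim\<close> denotes the genuine limit here, for every real
  \<open>y\<close>.\<close>

lemma pv_cauchy_eq_fourier:
  assumes cont: "continuous_on {a..b} f" and F: "integrable lborel (fourier (zero_ext {a..b} f))"
  shows "pv_cauchy {a..b} (zero_ext {a..b} f) y = - (\<i> / 2) *
    (LINT \<xi>|lborel. fourier (zero_ext {a..b} f) \<xi> * exp (- (\<i> * complex_of_real (y * \<xi>))) * complex_of_real (sgn \<xi>))"
  unfolding pv_cauchy_def
proof (intro tendsto_Lim principal_value_fourier integrable_zero_ext cont F)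
  show "AE x in lborel. zero_ext {a..b} f x =
    1 / (2 * pi) * (LINT \<xi>|lborel. fourier (zero_ext {a..b} f) \<xi> * exp (- (\<i> * complex_of_real (x * \<xi>))))"
    using AE_lborel_singleton[of a] AE_lborel_singleton[of b]
    by eventually_elim (rule zero_ext_fourier_inversion[OF cont F])
qed (auto simp: zero_ext_def)

theorem theorem4p3:
  fixes \<alpha> \<beta> :: "'n::{finite,linorder} \<Rightarrow> real"
    and \<Theta> :: "((real, 'n::{finite,linorder}) vec, 'n) vec"
    and s :: real
    and f :: "real \<Rightarrow> complex"
    and c :: "'n \<Rightarrow> complex"
  assumes "ordered_intervals \<alpha> \<beta>"
    and "1/2 < s" and "s < 1"
    and "transpose \<Theta> = \<Theta>" and "positive_definite \<Theta>"
    and "f \<in> Hdot s \<alpha> \<beta>"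
    and "\<And>j y. y \<in> {\<alpha> j..\<beta> j} \<Longrightarrow>
           1 / complex_of_real pi *
             (\<Sum>k\<in>UNIV. complex_of_real (\<Theta> $ j $ k) *
                pv_cauchy {\<alpha> k..\<beta> k} (zero_ext {\<alpha> k..\<beta> k} f) y) = c j"
  shows "(\<forall>j. c j = 0) \<and> (\<forall>x. f x = 0)"
proof -
  let ?z = "\<lambda>k. zero_ext {\<alpha> k..\<beta> k}"
  define F where "F k = fourier (?z k f)" for k
  \<comment> \<open>The Fourier form of the k-th principal value. It makes measurability and a
    uniform bound in \<open>y\<close> visible, both of which the pairing below relies on.\<close>
  define H where "H k y = - (\<i> / 2) * (LINT \<xi>|lborel. F k \<xi> * exp (- (\<i> * complex_of_real (y * \<xi>))) *
    complex_of_real (sgn \<xi>))" for k and y :: real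
  have lt: "\<alpha> j < \<beta> j" for j
    using assms(1) by (simp add: ordered_intervals_def)
  then have le: "\<alpha> j \<le> \<beta> j" for j
    by (rule less_imp_le)
  have s: "s \<le> 1" "1/2 \<le> s"
    using \<open>1/2 < s\<close> \<open>s < 1\<close> by auto
  from \<open>f \<in> Hdot s \<alpha> \<beta>\<close> have cont: "continuous_on {\<alpha> k..\<beta> k} f" for k
    by (auto simp: Hdot_def interval_union_def intro: continuous_on_subset)
  obtain \<phi> :: "nat \<Rightarrow> real \<Rightarrow> complex" where
    \<phi>: "\<And>m. \<phi> m \<in> C0_inf \<alpha> \<beta>" and
    diff_fin: "\<And>m k. integrable lborel (\<lambda>\<xi>. (cmod (F k \<xi> - fourier (?z k (\<phi> m)) \<xi>))\<^sup>2 * (1 + \<xi>\<^sup>2) powr s)" and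
    fin: "\<And>k. integrable lborel (\<lambda>\<xi>. (cmod (F k \<xi>))\<^sup>2 * (1 + \<xi>\<^sup>2) powr s)" and
    lim: "(\<lambda>m. \<Sum>k\<in>UNIV. LINT \<xi>|lborel. (cmod (F k \<xi> - fourier (?z k (\<phi> m)) \<xi>))\<^sup>2 * (1 + \<xi>\<^sup>2) powr s) \<longlonglongrightarrow> 0"
    unfolding F_def using HdotE[OF \<open>f \<in> Hdot s \<alpha> \<beta>\<close> s(1) le] by blast
  define P where "P m k = fourier (?z k (\<phi> m))" for m k
  have z_int: "integrable lborel (?z k f)" for k
    by (rule integrable_zero_ext[OF cont])
  have F_int: "integrable lborel (F k)" for k
    using fourier_integrable_of_sobolev[OF \<open>1/2 < s\<close> z_int] fin by (simp add: F_def)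
  have F_meas: "F k \<in> borel_measurable borel" for k
    using F_int[of k] by auto
  have pv: "pv_cauchy {\<alpha> k..\<beta> k} (?z k f) y = H k y" for k y
    unfolding H_def F_def using F_int by (intro pv_cauchy_eq_fourier cont) (simp add: F_def)
  have system: "(\<Sum>k\<in>UNIV. complex_of_real (\<Theta> $ j $ k) * H k y) = pi * c j" if "y \<in> {\<alpha> j..\<beta> j}" for j y
    using assms(7)[OF that] by (simp add: pv field_simps)
  have P_meas: "P m k \<in> borel_measurable borel" for m k
    unfolding P_def by (intro borel_measurable_fourier C0_inf_integrable \<phi>)
  \<comment> \<open>\<open>F k\<close> is integrable, and the quadratic decay of
    \<open>P m j\<close> keeps \<open>\<bar>\<xi>\<bar>\<close> times it bounded.\<close>
  have cross: "integrable lborel (\<lambda>\<xi>. complex_of_real \<bar>\<xi>\<bar> * (F k \<xi> * cnj (P m j \<xi>)))" for m j k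
  proof -
    obtain C where C: "\<And>\<xi>. (1 + \<xi>\<^sup>2) * cmod (P m j \<xi>) \<le> C"
      unfolding P_def using C0_inf_fourier_decay[OF \<phi> le] by blast
    have "integrable lborel (\<lambda>\<xi>. F k \<xi> * (complex_of_real \<bar>\<xi>\<bar> * cnj (P m j \<xi>)))"
    proof (rule integrable_bounded_factor[OF F_int])
      show "cmod (complex_of_real \<bar>\<xi>\<bar> * cnj (P m j \<xi>)) \<le> C" for \<xi>
      proof -
        have "\<bar>\<xi>\<bar> \<le> 1 + \<xi>\<^sup>2"
          using abs_le_bessel_weight[of 1 \<xi>] by (simp add: add_nonneg_nonneg)
        then have "\<bar>\<xi>\<bar> * cmod (P m j \<xi>) \<le> (1 + \<xi>\<^sup>2) * cmod (P m j \<xi>)"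
          by (intro mult_right_mono) auto
        with C[of \<xi>] show ?thesis
          by (simp add: norm_mult)
      qed
    qed (use P_meas in measurable)
    then show ?thesis
      by (simp only: mult.left_commute)
  qed
  have orth: "(\<Sum>k\<in>UNIV. complex_of_real (\<Theta> $ j $ k) *
      (LINT \<xi>|lborel. complex_of_real \<bar>\<xi>\<bar> * (F k \<xi> * cnj (P m j \<xi>)))) = 0" for m j
  proof -
    obtain \<phi>' where \<phi>': "\<And>x. x \<in> {\<alpha> j..\<beta> j} \<Longrightarrow> (\<phi> m has_vector_derivative \<phi>' x) (at x within {\<alpha> j..\<beta> j})"
      and cont': "continuous_on {\<alpha> j..\<beta> j} \<phi>'" and zero: "\<phi> m (\<alpha> j) = 0" "\<phi> m (\<beta> j) = 0"
      using \<phi>[of m] by (elim C0_infE) (metis continuous_on_vector_derivative)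
    have z'_int: "integrable lborel (\<lambda>y. cnj (?z j \<phi>' y))"
      using integrable_zero_ext[OF cont'] by simp
    \<comment> \<open>The transform at 0 is the total integral, and the boundary values of
      \<open>\<phi> m\<close> vanish. That \<open>\<phi>'\<close> has mean zero on each interval is
      what eliminates the unknown constant.\<close>
    have "(LINT y|lborel. cnj (?z j \<phi>' y)) = cnj (fourier (?z j \<phi>') 0)"
      by (simp add: fourier_def)
    also have "\<dots> = 0"
      using fourier_zero_ext_deriv[OF le \<phi>' cont', of 0] by (simp add: zero)
    finally have mean_0: "(LINT y|lborel. cnj (?z j \<phi>' y)) = 0" .
    have H_meas: "H k \<in> borel_measurable borel" for k
      using F_meas unfolding H_def by measurable
    have H_bound: "cmod (H k y) \<le> 1 / 2 * (LINT \<xi>|lborel. cmod (F k \<xi>))" for k y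
    proof -
      have "cmod (LINT \<xi>|lborel. F k \<xi> * exp (- (\<i> * complex_of_real (y * \<xi>))) * complex_of_real (sgn \<xi>)) \<le>
          (LINT \<xi>|lborel. cmod (F k \<xi>))"
        using F_int by (intro Bochner_Integration.integral_norm_bound_integral integrable_bounded_factor[where B=1])
          (auto simp: norm_mult sgn_if)
      then show ?thesis
        by (simp add: H_def norm_mult)
    qed
    have zH_int: "integrable lborel (\<lambda>y. cnj (?z j \<phi>' y) * H k y)" for k
      by (rule integrable_bounded_factor[OF z'_int H_meas H_bound])
    have "(\<Sum>k\<in>UNIV. complex_of_real (\<Theta> $ j $ k) * (1 / 2 *
        (LINT \<xi>|lborel. complex_of_real \<bar>\<xi>\<bar> * (F k \<xi> * cnj (P m j \<xi>))))) =
      (\<Sum>k\<in>UNIV. complex_of_real (\<Theta> $ j $ k) * (LINT y|lborel. cnj (?z j \<phi>' y) * H k y))"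
      unfolding H_def P_def
      by (intro sum.cong refl arg_cong2[where f="(*)"] hilbert_deriv_pairing[symmetric] le F_int \<phi>' cont' zero)
    also have "\<dots> = (LINT y|lborel. (\<Sum>k\<in>UNIV. complex_of_real (\<Theta> $ j $ k) * (cnj (?z j \<phi>' y) * H k y)))"
      by (subst Bochner_Integration.integral_sum) (auto intro!: zH_int)
    also have "\<dots> = (LINT y|lborel. (pi * c j) * cnj (?z j \<phi>' y))"
    proof (intro Bochner_Integration.integral_cong refl)
      fix y
      have "(\<Sum>k\<in>UNIV. complex_of_real (\<Theta> $ j $ k) * (cnj (?z j \<phi>' y) * H k y)) =
          (\<Sum>k\<in>UNIV. complex_of_real (\<Theta> $ j $ k) * H k y) * cnj (?z j \<phi>' y)"
        unfolding sum_distrib_right by (simp only: mult_ac)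
      also have "\<dots> = (pi * c j) * cnj (?z j \<phi>' y)"
        \<comment> \<open>Outside the j-th interval the extension of \<open>\<phi>'\<close> is 0, so
          the equation is invoked only where it is assumed.\<close>
        using system[of y j] by (cases "y \<in> {\<alpha> j..\<beta> j}") (auto simp: zero_ext_def)
      finally show "(\<Sum>k\<in>UNIV. complex_of_real (\<Theta> $ j $ k) * (cnj (?z j \<phi>' y) * H k y)) = (pi * c j) * cnj (?z j \<phi>' y)" .
    qed
    also have "\<dots> = 0"
      by (simp only: integral_mult_right_zero mean_0 mult_zero_right)
    finally have "1 / 2 * (\<Sum>k\<in>UNIV. complex_of_real (\<Theta> $ j $ k) *
        (LINT \<xi>|lborel. complex_of_real \<bar>\<xi>\<bar> * (F k \<xi> * cnj (P m j \<xi>)))) = 0"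
      unfolding sum_distrib_left by (simp only: mult.left_commute[of "1 / 2"])
    then show ?thesis
      by simp
  qed
  let ?e = "\<lambda>\<xi>. \<bar>\<xi>\<bar> * Re (sesquilinear_form \<Theta> (\<lambda>k. F k \<xi>) (\<lambda>k. F k \<xi>))"
  have e_int: "integrable lborel ?e"
    by (rule integrable_energy(1)[OF s(2) F_meas fin])
  have e_nonneg: "0 \<le> ?e \<xi>" for \<xi>
    by (intro mult_nonneg_nonneg sesquilinear_form_nonneg assms) auto
  have "integral\<^sup>L lborel ?e \<le> (\<Sum>j\<in>UNIV. \<Sum>k\<in>UNIV. \<bar>\<Theta> $ j $ k\<bar>) *
      (\<Sum>k\<in>UNIV. LINT \<xi>|lborel. (cmod (F k \<xi> - P m k \<xi>))\<^sup>2 * (1 + \<xi>\<^sup>2) powr s)" for m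
    using diff_fin[of _ m] unfolding P_def[symmetric]
    by (intro energy_le_of_orthogonal assms(4,5) s(2) F_meas P_meas fin cross orth)
  moreover have "(\<lambda>m. (\<Sum>j\<in>UNIV. \<Sum>k\<in>UNIV. \<bar>\<Theta> $ j $ k\<bar>) *
      (\<Sum>k\<in>UNIV. LINT \<xi>|lborel. (cmod (F k \<xi> - P m k \<xi>))\<^sup>2 * (1 + \<xi>\<^sup>2) powr s)) \<longlonglongrightarrow>
      (\<Sum>j\<in>UNIV. \<Sum>k\<in>UNIV. \<bar>\<Theta> $ j $ k\<bar>) * 0"
    using lim unfolding P_def by (intro tendsto_mult tendsto_const)
  \<comment> \<open>The energy of \<open>f\<close> is independent of \<open>m\<close> and lies below
    a sequence that tends to 0.\<close>
  ultimately have "integral\<^sup>L lborel ?e \<le> 0"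
    by (intro LIMSEQ_le_const[where x=0]) (auto simp only: mult_zero_right)
  moreover have "0 \<le> integral\<^sup>L lborel ?e"
    using e_nonneg by (intro Bochner_Integration.integral_nonneg)
  ultimately have "integral\<^sup>L lborel ?e = 0"
    by simp
  then have "AE \<xi> in lborel. ?e \<xi> = 0"
    using e_nonneg by (subst (asm) integral_nonneg_eq_0_iff_AE[OF e_int]) auto
  \<comment> \<open>The factor \<open>\<bar>\<xi>\<bar>\<close> hides the form at \<xi> = 0; this
    single point is discarded before definiteness is applied.\<close>
  then have F_0: "AE \<xi> in lborel. F k \<xi> = 0" for k
    using AE_lborel_singleton[of 0]
    by eventually_elim (auto intro: sesquilinear_form_eq_0D[OF assms(5)])
  have F_integral_0: "(LINT \<xi>|lborel. F k \<xi> * g \<xi>) = 0" if "g \<in> borel_measurable borel" for k and g :: "real \<Rightarrow> complex"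
  proof -
    have "(LINT \<xi>|lborel. F k \<xi> * g \<xi>) = (LINT \<xi>|(lborel :: real measure). 0 :: complex)"
      using F_0[of k] F_meas[of k] that by (intro integral_cong_AE) auto
    then show ?thesis
      by simp
  qed
  have "H k y = 0" for k y
    unfolding H_def mult.assoc by (subst F_integral_0) auto
  \<comment> \<open>With all principal values zero, one point of each interval suffices to read off
    its constant; the left endpoint is taken.\<close>
  then have "c j = 0" for j
    using system[of "\<alpha> j" j] le[of j] by simp
  moreover have "f x = 0" for x
  proof (cases "x \<in> interval_union \<alpha> \<beta>")
    case True
    then obtain k where k: "x \<in> {\<alpha> k..\<beta> k}"
      by (auto simp: interval_union_def)
    have interior: "f y = 0" if "y \<in> {\<alpha> k<..<\<beta> k}" for y
    proof -
      have "?z k f y = 0"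
        using that zero_ext_fourier_inversion[OF cont[of k], of y] F_int[of k] F_integral_0[of "\<lambda>\<xi>. exp (- (\<i> * complex_of_real (y * \<xi>)))" k]
        by (simp add: F_def)
      with that show ?thesis
        by (simp add: zero_ext_def)
    qed
    \<comment> \<open>Inversion covers the interior only. The endpoints follow by continuity, since
      a nondegenerate closed interval is the closure of its interior.\<close>
    have "continuous_on (closure {\<alpha> k<..<\<beta> k}) f" "x \<in> closure {\<alpha> k<..<\<beta> k}"
      using cont[of k] k lt[of k] by auto
    then show ?thesis
      by (intro continuous_constant_on_closure[OF _ interior])
  next
    case False
    then show ?thesis
      using \<open>f \<in> Hdot s \<alpha> \<beta>\<close> by (simp add: Hdot_def)
  qed
  ultimately show ?thesis
    by blast
qed

end
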